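(* Let $H\neq K_q^+$ be an arbitrary constraint graph. Suppose $G$ is an $n$-vertex $H$-colorable graph such that $\pi_G$ satisfies the Dobrushin uniqueness condition. Then there is a structure learning algorithm that, given $L=O(q^2\log(n^2/\varepsilon))$ independent samples from $\pi_G$, outputs the graph $G$ with probability at least $1-\varepsilon$ and has running time $O(Ln^2)$.
   Context: A constraint graph $H$ is an undirected connected graph on vertex set $\{1,\dots,q\}$ (colors), possibly with self-loops, no parallel edges; $K_q^+$ is the complete graph on $q$ vertices with a self-loop at every vertex. An $H$-coloring of $G=(V,E)$ is a map $\sigma:V\to\{1,\dots,q\}$ with $\{\sigma(v),\sigma(w)\}\in E(H)$ for all $\{v,w\}\in E$; $\pi_G$ is the uniform distribution on the $H$-colorings of $G$. Dobrushin uniqueness condition: for $w\in V$ let $S_w$ be the set of pairs $(\tau,\tau_w)$ of assignments in $\{1,\dots,q\}^V$ with $\tau(z)=\tau_w(z)$ for all $z\neq w$. For $v,w\in V$ let $R_{vw}=\max_{(\tau,\tau_w)\in S_w}\|\pi_v(\cdot\mid\tau(\partial v))-\pi_v(\cdot\mid\tau_w(\partial v))\|_{TV}$, where $\partial v$ is the neighborhood of $v$ in $G$ and $\pi_v(\cdot\mid\tau(\partial v))$ is the conditional distribution under $\pi_G$ of the color of $v$ given that the neighbors of $v$ are colored according to $\tau$. Let $\alpha=\max_{v\in V}\sum_{w\in\partial v}R_{vw}$; the condition holds when $\alpha<1$. A structure learning algorithm receives independent samples from $\pi_G$ and outputs a graph on $V$; success means the output equals $G$. *)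

theory Defs
  imports "HOL-Probability.Probability"
begin

text \<open>Edges are the sets \<open>{v, w}\<close>; a self-loop at \<open>v\<close> is the singleton \<open>{v, v} = {v}\<close>.\<close>

record graph =
  verts :: "nat set"
  edges :: "nat set set"

definition simple_graph :: "graph \<Rightarrow> bool" where
  "simple_graph G \<longleftrightarrow> finite (verts G) \<and> (\<forall>e\<in>edges G. e \<subseteq> verts G \<and> card e = 2)"

definition connected_graph :: "graph \<Rightarrow> bool" where
  "connected_graph G \<longleftrightarrow>
     verts G \<noteq> {} \<and> (\<forall>v\<in>verts G. \<forall>w\<in>verts G. (v, w) \<in> {(a, b). {a, b} \<in> edges G}\<^sup>*)"

definition looped_complete :: "nat \<Rightarrow> graph" where
  "looped_complete q = \<lparr>verts = {1..q}, edges = {{i, j} |i j. i \<in> {1..q} \<and> j \<in> {1..q}}\<rparr>"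

definition constraint_graph :: "nat \<Rightarrow> graph \<Rightarrow> bool" where
  "constraint_graph q H \<longleftrightarrow>
     verts H = {1..q} \<and> edges H \<subseteq> edges (looped_complete q) \<and> connected_graph H"

definition neighborhood :: "graph \<Rightarrow> nat \<Rightarrow> nat set" where
  "neighborhood G v = {w \<in> verts G. {v, w} \<in> edges G}"

definition colorings :: "graph \<Rightarrow> graph \<Rightarrow> (nat \<Rightarrow> nat) set" where
  "colorings H G =
     {\<sigma> \<in> verts G \<rightarrow>\<^sub>E verts H. \<forall>v\<in>verts G. \<forall>w\<in>verts G. {v, w} \<in> edges G \<longrightarrow> {\<sigma> v, \<sigma> w} \<in> edges H}"

definition colorable :: "graph \<Rightarrow> graph \<Rightarrow> bool" where
  "colorable H G \<longleftrightarrow> colorings H G \<noteq> {}"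

definition coloring_pmf :: "graph \<Rightarrow> graph \<Rightarrow> (nat \<Rightarrow> nat) pmf" where
  "coloring_pmf H G = pmf_of_set (colorings H G)"

definition available :: "graph \<Rightarrow> graph \<Rightarrow> nat \<Rightarrow> (nat \<Rightarrow> nat) \<Rightarrow> nat set" where
  "available H G v \<tau> = {c \<in> verts H. \<forall>z\<in>neighborhood G v. {c, \<tau> z} \<in> edges H}"

text \<open>
  The probability that \<open>v\<close> has color \<open>c\<close>, given that its neighbors are colored according to \<open>\<tau>\<close>.
  The Dobrushin condition ranges over all assignments \<open>\<tau>\<close>, including those for which the
  conditioning event has probability 0 (for instance because two neighbors of \<open>v\<close> are adjacent and
  receive incompatible colors). There the usual local specification is used, namely the uniform
  distribution on the colors compatible with \<open>\<tau>\<close> on the neighborhood; \<open>site_cond_eq\<close> below shows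
  that the conditional probability is given by the same formula whenever it is defined.

  If no color at all is compatible with \<open>\<tau>\<close>, then the value is constantly 0. Its distance
  \<open>tv_dist\<close> from any probability distribution is 1.
\<close>

definition site_cond :: "graph \<Rightarrow> graph \<Rightarrow> nat \<Rightarrow> (nat \<Rightarrow> nat) \<Rightarrow> nat \<Rightarrow> real" where
  "site_cond H G v \<tau> c =
     (if measure_pmf.prob (coloring_pmf H G) {\<sigma>. \<forall>z\<in>neighborhood G v. \<sigma> z = \<tau> z} > 0
      then cond_prob (measure_pmf (coloring_pmf H G))
             (\<lambda>\<sigma>. \<sigma> v = c) (\<lambda>\<sigma>. \<forall>z\<in>neighborhood G v. \<sigma> z = \<tau> z)
      else if c \<in> available H G v \<tau> then 1 / card (available H G v \<tau>) else 0)"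

definition tv_dist :: "nat set \<Rightarrow> (nat \<Rightarrow> real) \<Rightarrow> (nat \<Rightarrow> real) \<Rightarrow> real" where
  "tv_dist A \<mu> \<nu> = Max ((\<lambda>B. \<bar>sum \<mu> B - sum \<nu> B\<bar>) ` Pow A)"

definition assignments_off :: "graph \<Rightarrow> graph \<Rightarrow> nat \<Rightarrow> ((nat \<Rightarrow> nat) \<times> (nat \<Rightarrow> nat)) set" where
  "assignments_off H G w =
     {(\<tau>, \<tau>'). \<tau> \<in> verts G \<rightarrow>\<^sub>E verts H \<and> \<tau>' \<in> verts G \<rightarrow>\<^sub>E verts H \<and>
        (\<forall>z\<in>verts G. z \<noteq> w \<longrightarrow> \<tau> z = \<tau>' z)}"

definition influence :: "graph \<Rightarrow> graph \<Rightarrow> nat \<Rightarrow> nat \<Rightarrow> real" where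
  "influence H G v w =
     Max ((\<lambda>(\<tau>, \<tau>'). tv_dist (verts H) (site_cond H G v \<tau>) (site_cond H G v \<tau>'))
            ` assignments_off H G w)"

definition dobrushin_coefficient :: "graph \<Rightarrow> graph \<Rightarrow> real" where
  "dobrushin_coefficient H G =
     Max ((\<lambda>v. \<Sum>w\<in>neighborhood G v. influence H G v w) ` verts G)"

definition dobrushin :: "graph \<Rightarrow> graph \<Rightarrow> bool" where
  "dobrushin H G \<longleftrightarrow> dobrushin_coefficient H G < 1"

text \<open>
  Algorithms are programs for a random access machine with the uniform cost measure. The machine
  has a memory of natural numbers, addressed directly (the arguments of the instructions are
  addresses) or indirectly (\<open>Load\<close>, \<open>Store\<close>); random access to the adjacency matrix of the
  constraint graph and to the table of samples, which are read-only; and a writable output matrix.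
  Every instruction and every evaluation of a test takes one unit of time. There is no
  multiplication, so \<open>t\<close> steps only produce numbers with \<open>O(t)\<close> more bits than the input.
\<close>

record learning_input =
  constraint :: graph
  num_verts :: nat
  num_samples :: nat
  sample :: "nat \<Rightarrow> nat \<Rightarrow> nat"

record state =
  mem :: "nat \<Rightarrow> nat"
  out :: "nat \<Rightarrow> nat \<Rightarrow> nat"

datatype prog =
    Skip
  | Const nat nat
  | Add nat nat nat
  | Sub nat nat nat
  | Load nat nat
  | Store nat nat
  | Read_Constraint nat nat nat
  | Read_Sample nat nat nat
  | Write_Out nat nat nat
  | Seq prog prog
  | If_Less nat nat prog prog
  | While_Less nat nat prog

definition assign :: "nat \<Rightarrow> nat \<Rightarrow> state \<Rightarrow> state" where
  "assign x k s = s\<lparr>mem := (mem s)(x := k)\<rparr>"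

definition constraint_entry :: "learning_input \<Rightarrow> nat \<Rightarrow> nat \<Rightarrow> nat" where
  "constraint_entry inp i j = (if {i, j} \<in> edges (constraint inp) then 1 else 0)"

definition sample_entry :: "learning_input \<Rightarrow> nat \<Rightarrow> nat \<Rightarrow> nat" where
  "sample_entry inp l v = (if l < num_samples inp \<and> v < num_verts inp then sample inp l v else 0)"

text \<open>
  \<open>exec inp c s t s'\<close>: started in state \<open>s\<close>, the program \<open>c\<close> halts in state \<open>s'\<close> after
  \<open>t\<close> units of time.
\<close>

inductive exec :: "learning_input \<Rightarrow> prog \<Rightarrow> state \<Rightarrow> nat \<Rightarrow> state \<Rightarrow> bool"
  for inp :: learning_input where
  Skip: "exec inp Skip s 1 s"
| Const: "exec inp (Const x k) s 1 (assign x k s)"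
| Add: "exec inp (Add x y z) s 1 (assign x (mem s y + mem s z) s)"
| Sub: "exec inp (Sub x y z) s 1 (assign x (mem s y - mem s z) s)"
| Load: "exec inp (Load x y) s 1 (assign x (mem s (mem s y)) s)"
| Store: "exec inp (Store x y) s 1 (assign (mem s x) (mem s y) s)"
| Read_Constraint:
    "exec inp (Read_Constraint x y z) s 1 (assign x (constraint_entry inp (mem s y) (mem s z)) s)"
| Read_Sample:
    "exec inp (Read_Sample x y z) s 1 (assign x (sample_entry inp (mem s y) (mem s z)) s)"
| Write_Out:
    "exec inp (Write_Out y z x) s 1
       (s\<lparr>out := (out s)(mem s y := (out s (mem s y))(mem s z := mem s x))\<rparr>)"
| Seq: "exec inp c1 s t1 s1 \<Longrightarrow> exec inp c2 s1 t2 s2 \<Longrightarrow> exec inp (Seq c1 c2) s (t1 + t2) s2"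
| If_True: "mem s x < mem s y \<Longrightarrow> exec inp c1 s t s1 \<Longrightarrow> exec inp (If_Less x y c1 c2) s (Suc t) s1"
| If_False:
    "\<not> mem s x < mem s y \<Longrightarrow> exec inp c2 s t s1 \<Longrightarrow> exec inp (If_Less x y c1 c2) s (Suc t) s1"
| While_False: "\<not> mem s x < mem s y \<Longrightarrow> exec inp (While_Less x y c) s 1 s"
| While_True:
    "mem s x < mem s y \<Longrightarrow> exec inp c s t1 s1 \<Longrightarrow> exec inp (While_Less x y c) s1 t2 s2 \<Longrightarrow>
     exec inp (While_Less x y c) s (Suc (t1 + t2)) s2"

definition initial_state :: "learning_input \<Rightarrow> state" where
  "initial_state inp =
     \<lparr>mem = (\<lambda>_. 0)(0 := card (verts (constraint inp)), 1 := num_verts inp, 2 := num_samples inp),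
      out = (\<lambda>_ _. 0)\<rparr>"

definition output_graph :: "learning_input \<Rightarrow> state \<Rightarrow> graph" where
  "output_graph inp s =
     \<lparr>verts = {..<num_verts inp},
      edges = {{v, w} |v w. v < num_verts inp \<and> w < num_verts inp \<and> out s v w \<noteq> 0}\<rparr>"

definition halts_within :: "prog \<Rightarrow> learning_input \<Rightarrow> real \<Rightarrow> bool" where
  "halts_within c inp T \<longleftrightarrow> (\<exists>t s. exec inp c (initial_state inp) t s \<and> real t \<le> T)"

definition outputs :: "prog \<Rightarrow> learning_input \<Rightarrow> graph \<Rightarrow> bool" where
  "outputs c inp G \<longleftrightarrow> (\<exists>t s. exec inp c (initial_state inp) t s \<and> output_graph inp s = G)"

definition learning_instance :: "graph \<Rightarrow> nat \<Rightarrow> nat \<Rightarrow> (nat \<Rightarrow> nat \<Rightarrow> nat) \<Rightarrow> learning_input" where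
  "learning_instance H n L X =
     \<lparr>constraint = H, num_verts = n, num_samples = L, sample = X\<rparr>"

definition samples_pmf :: "graph \<Rightarrow> graph \<Rightarrow> nat \<Rightarrow> (nat \<Rightarrow> nat \<Rightarrow> nat) pmf" where
  "samples_pmf H G L = Pi_pmf {..<L} undefined (\<lambda>_. coloring_pmf H G)"

lemma exec_deterministic:
  "exec inp c s t s1 \<Longrightarrow> exec inp c s t' s2 \<Longrightarrow> t' = t \<and> s2 = s1"
proof (induction arbitrary: t' s2 rule: exec.induct)
  case (Seq c1 s t1 s1 c2 t2 s2')
  from Seq.prems show ?case by cases (use Seq.IH in blast)
next
  case (While_True s x y c t1 s1 t2 s2')
  from While_True.prems show ?case by cases (use While_True.IH While_True.hyps in blast)+
qed (erule exec.cases; fastforce)+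

lemma finite_colorings:
  assumes "finite (verts G)" "finite (verts H)"
  shows "finite (colorings H G)"
  by (rule finite_subset[OF _ finite_PiE[OF assms(1), of "\<lambda>_. verts H"]])
     (use assms in \<open>auto simp: colorings_def\<close>)

lemma colorings_update:
  assumes G: "simple_graph G" and v: "v \<in> verts G"
    and \<sigma>: "\<sigma> \<in> colorings H G" and c: "c \<in> available H G v \<sigma>"
  shows "\<sigma>(v := c) \<in> colorings H G"
proof -
  have no_loop: "{v, v} \<notin> edges G"
    using G by (auto simp: simple_graph_def)
  have "{(\<sigma>(v := c)) a, (\<sigma>(v := c)) b} \<in> edges H"
    if "a \<in> verts G" "b \<in> verts G" "{a, b} \<in> edges G" for a b
    using that \<sigma> c no_loop
    by (auto simp: colorings_def available_def neighborhood_def insert_commute)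
  moreover have "\<sigma>(v := c) \<in> verts G \<rightarrow>\<^sub>E verts H"
    using \<sigma> c v by (auto simp: colorings_def available_def PiE_iff extensional_def)
  ultimately show ?thesis by (simp add: colorings_def)
qed

lemma site_cond_eq:
  assumes G: "simple_graph G" and H: "finite (verts H)" and col: "colorable H G"
    and v: "v \<in> verts G"
  shows "site_cond H G v \<tau> c =
           (if c \<in> available H G v \<tau> then 1 / card (available H G v \<tau>) else 0)"
proof -
  define \<Omega> where "\<Omega> = colorings H G"
  define B where "B = {\<sigma>. \<forall>z\<in>neighborhood G v. \<sigma> z = \<tau> z}"
  define A where "A = available H G v \<tau>"
  define F where "F a = {\<sigma>\<in>\<Omega>. \<sigma> \<in> B \<and> \<sigma> v = a}" for a
  have fin: "finite \<Omega>" and ne: "\<Omega> \<noteq> {}"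
    using finite_colorings G H col by (auto simp: \<Omega>_def simple_graph_def colorable_def)
  have finF: "finite (F a)" for a using fin by (simp add: F_def)
  have finA: "finite A" using H by (simp add: A_def available_def)
  have v_nbh: "v \<notin> neighborhood G v"
    using G by (auto simp: simple_graph_def neighborhood_def)
  have av: "available H G v \<sigma> = A" if "\<sigma> \<in> B" for \<sigma>
    using that by (auto simp: A_def B_def available_def)
  have F_A: "a \<in> A" if "\<sigma> \<in> F a" for a \<sigma>
  proof -
    have "a \<in> available H G v \<sigma>"
      using that v by (auto simp: F_def \<Omega>_def colorings_def available_def neighborhood_def)
    then show ?thesis using av that by (auto simp: F_def)
  qed
  have upd: "\<sigma>(v := b) \<in> F b" if "\<sigma> \<in> F a" "b \<in> A" for \<sigma> a b
  proof -
    have "\<sigma>(v := b) \<in> colorings H G"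
      using that av by (intro colorings_update[OF G v]) (auto simp: F_def \<Omega>_def)
    moreover have "\<sigma>(v := b) \<in> B"
      using that v_nbh by (auto simp: F_def B_def)
    ultimately show ?thesis by (simp add: F_def \<Omega>_def)
  qed
  have le: "card (F a) \<le> card (F b)" if "a \<in> A" "b \<in> A" for a b
  proof (rule card_inj_on_le[where f = "\<lambda>\<sigma>. \<sigma>(v := b)"])
    show "inj_on (\<lambda>\<sigma>. \<sigma>(v := b)) (F a)"
    proof (rule inj_onI)
      fix x y assume xy: "x \<in> F a" "y \<in> F a" "x(v := b) = y(v := b)"
      show "x = y"
      proof
        fix z
        show "x z = y z"
        proof (cases "z = v")
          case True then show ?thesis using xy by (simp add: F_def)
        next
          case False then show ?thesis using fun_cong[OF xy(3), of z] by simp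
        qed
      qed
    qed
    show "(\<lambda>\<sigma>. \<sigma>(v := b)) ` F a \<subseteq> F b" using upd that by blast
  qed (rule finF)
  have B_eq: "\<Omega> \<inter> B = (\<Union>a\<in>A. F a)"
    using F_A by (auto simp: F_def)
  have card_B: "card (\<Omega> \<inter> B) = (\<Sum>a\<in>A. card (F a))"
    unfolding B_eq by (rule card_UN_disjoint) (use finA finF in \<open>auto simp: F_def\<close>)
  have prob: "measure_pmf.prob (coloring_pmf H G) S = card (\<Omega> \<inter> S) / card \<Omega>" for S
    unfolding coloring_pmf_def \<Omega>_def[symmetric] by (rule measure_pmf_of_set[OF ne fin])
  have ev: "\<Omega> \<inter> {\<sigma>. \<sigma> v = c \<and> \<sigma> \<in> B} = F c" by (auto simp: F_def)
  show ?thesis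
  proof (cases "measure_pmf.prob (coloring_pmf H G) B > 0")
    case False
    then show ?thesis by (simp add: site_cond_def B_def)
  next
    case True
    have cond: "site_cond H G v \<tau> c = card (F c) / card (\<Omega> \<inter> B)"
    proof -
      have "site_cond H G v \<tau> c =
          measure_pmf.prob (coloring_pmf H G) {\<sigma>. \<sigma> v = c \<and> \<sigma> \<in> B} /
          measure_pmf.prob (coloring_pmf H G) B"
        using True by (simp add: site_cond_def cond_prob_def B_def)
      then show ?thesis
        using fin ne by (simp add: prob ev)
    qed
    have pos: "card (\<Omega> \<inter> B) > 0"
      using True fin ne by (auto simp: prob zero_less_divide_iff)
    show ?thesis
    proof (cases "c \<in> A")
      case True
      have "card (F a) = card (F c)" if "a \<in> A" for a
        using le that True by (meson le_antisym)
      then have "card (\<Omega> \<inter> B) = card A * card (F c)"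
        by (simp add: card_B)
      then show ?thesis
        using cond pos True by (simp add: A_def field_simps)
    next
      case False
      then have "F c = {}" using F_A by blast
      then show ?thesis using cond False by (simp add: A_def)
    qed
  qed
qed

end

theory Submission
  imports Defs
begin

text \<open>
  Declare \<open>{v, w}\<close> an edge iff the two colors are compatible in every sample. An edge is never
  missed, so it suffices that a pair of distinct nonadjacent vertices is incompatible with
  probability at least \<open>1 / (64 q\<^sup>2)\<close>: the union bound over the pairs then gives the sample size.

  Let \<open>D\<close> be the maximum degree of \<open>G\<close>. The Dobrushin condition at a vertex of degree \<open>D\<close> forces
  every set \<open>T\<close> of at most \<open>D\<close> colors and every color \<open>i\<close> to have the property that all but a
  fraction \<open>1 / D\<close> of the common neighbors of \<open>T\<close> in \<open>H\<close> are neighbors of \<open>i\<close>. So each neighbor of \<open>v\<close>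
  has a color compatible with \<open>i\<close> with probability at least \<open>1 - 1 / D\<close>, given all the other colors;
  hence \<open>v\<close> has color \<open>i\<close> with probability at least \<open>(1 - 1 / D)^D / q\<close>, and then \<open>w\<close> has color \<open>j\<close> with
  the same conditional probability. For \<open>D \<ge> 2\<close> any incompatible pair \<open>(i, j)\<close> will do. If \<open>D \<le> 1\<close>,
  then \<open>v\<close> has color \<open>i\<close> with probability at least \<open>deg i / q\<^sup>2\<close>, and summing over all incompatible
  pairs gives the bound.
\<close>

section \<open>Common neighborhoods in the constraint graph\<close>

text \<open>The colors available at a vertex depend only on the set of colors around it; working
  with sets lets a bound obtained at one vertex be applied at the others.\<close>

definition color_nbrs :: "graph \<Rightarrow> nat set \<Rightarrow> nat set" where
  "color_nbrs H T = {c \<in> verts H. \<forall>z\<in>T. {c, z} \<in> edges H}"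

lemma available_eq: "available H G v \<tau> = color_nbrs H (\<tau> ` neighborhood G v)"
  by (simp add: available_def color_nbrs_def)

lemma finite_color_nbrs: "finite (verts H) \<Longrightarrow> finite (color_nbrs H T)"
  by (simp add: color_nbrs_def)

lemma finite_neighborhood: "simple_graph G \<Longrightarrow> finite (neighborhood G v)"
  by (simp add: simple_graph_def neighborhood_def)

lemma not_in_neighborhood: "simple_graph G \<Longrightarrow> v \<notin> neighborhood G v"
  by (auto simp: simple_graph_def neighborhood_def)

lemma neighborhood_sym:
  "v \<in> verts G \<Longrightarrow> w \<in> neighborhood G v \<Longrightarrow> v \<in> neighborhood G w"
  by (simp add: neighborhood_def insert_commute)

subsection \<open>The Dobrushin condition\<close>

lemma tv_dist_ge:
  assumes "finite A" "B \<subseteq> A"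
  shows "\<bar>sum \<mu> B - sum \<nu> B\<bar> \<le> tv_dist A \<mu> \<nu>"
  unfolding tv_dist_def using assms by (intro Max_ge) auto

lemma influence_ge:
  assumes G: "finite (verts G)" and H: "finite (verts H)"
    and \<tau>: "(\<tau>, \<tau>') \<in> assignments_off H G w"
  shows "tv_dist (verts H) (site_cond H G v \<tau>) (site_cond H G v \<tau>') \<le> influence H G v w"
proof -
  have "finite ((verts G \<rightarrow>\<^sub>E verts H) \<times> (verts G \<rightarrow>\<^sub>E verts H))"
    using G H by (intro finite_cartesian_product finite_PiE) auto
  then have "finite (assignments_off H G w)"
    by (rule rev_finite_subset) (auto simp: assignments_off_def)
  then show ?thesis
    unfolding influence_def using \<tau> by (intro Max_ge) (auto intro!: image_eqI[OF _ \<tau>])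
qed

text \<open>
  The total influence on \<open>v\<close> is less than 1, so some neighbor \<open>w\<close> has influence below the average
  \<open>1 / card (neighborhood G v)\<close>. Spread the colors of \<open>T\<close> over the neighborhood and recolor \<open>w\<close>
  with \<open>i\<close>: the event that \<open>v\<close> has a color that is lost bounds the total variation distance from
  below.
\<close>

lemma dobrushin_color_loss:
  assumes G: "simple_graph G" and H: "finite (verts H)" and col: "colorable H G"
    and dob: "dobrushin H G" and v: "v \<in> verts G"
    and T: "T \<subseteq> verts H" "T \<noteq> {}" "card T \<le> card (neighborhood G v)" and i: "i \<in> verts H"
  shows "card (neighborhood G v) * card (color_nbrs H T - color_nbrs H {i}) \<le> card (color_nbrs H T)"
proof (cases "color_nbrs H T = {}")
  case True
  then show ?thesis by simp
next
  case False
  define N where "N = neighborhood G v"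
  have finN: "finite N" using G by (simp add: N_def finite_neighborhood)
  have finG: "finite (verts G)" using G by (simp add: simple_graph_def)
  have finT: "finite T" using T H finite_subset by blast
  have D0: "card N > 0" using T finT by (metis N_def card_gt_0_iff le_zero_eq gr0I)
  have "(\<Sum>w\<in>N. influence H G v w) \<le> dobrushin_coefficient H G"
    unfolding dobrushin_coefficient_def N_def using finG v by (intro Max_ge) auto
  then have lt: "(\<Sum>w\<in>N. influence H G v w) < 1" using dob by (simp add: dobrushin_def)
  have "\<exists>w\<in>N. influence H G v w < 1 / card N"
  proof (rule ccontr)
    assume "\<not> ?thesis"
    then have "(\<Sum>w\<in>N. 1 / card N) \<le> (\<Sum>w\<in>N. influence H G v w)"
      by (intro sum_mono) (auto simp: not_less)
    then show False using lt D0 by simp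
  qed
  then obtain w where w: "w \<in> N" "influence H G v w < 1 / card N" by blast
  have "\<exists>g. inj_on g T \<and> g ` T \<subseteq> N"
    using T finT finN by (metis N_def card_le_inj)
  \<comment> \<open>Inverting an injection of \<open>T\<close> into \<open>N\<close> gives a
    surjection, so the neighborhood can display exactly the colors of \<open>T\<close>.\<close>
  then obtain f where f: "f ` N = T" unfolding inj_on_iff_surj[OF T(2)] by (elim exE)
  define \<tau> where "\<tau> = (\<lambda>z\<in>verts G. if z \<in> N then f z else i)"
  define \<tau>' where "\<tau>' = \<tau>(w := i)"
  have NG: "N \<subseteq> verts G" by (auto simp: N_def neighborhood_def)
  have off: "(\<tau>, \<tau>') \<in> assignments_off H G w"
    using f T i w NG by (auto simp: assignments_off_def \<tau>_def \<tau>'_def PiE_iff extensional_def)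
  have "\<tau> ` N = T" using f NG by (force simp: \<tau>_def)
  then have A: "available H G v \<tau> = color_nbrs H T" by (simp add: available_eq N_def)
  define A' where "A' = available H G v \<tau>'"
  have A': "A' \<subseteq> color_nbrs H {i}"
    using w by (auto simp: A'_def \<tau>'_def available_def color_nbrs_def N_def)
  let ?B = "color_nbrs H T - A'"
  note sc = site_cond_eq[OF G H col v]
  have 1: "sum (site_cond H G v \<tau>) ?B = card ?B / card (color_nbrs H T)"
  proof -
    have "sum (site_cond H G v \<tau>) ?B = (\<Sum>c\<in>?B. 1 / card (color_nbrs H T))"
      by (rule sum.cong) (auto simp: sc A)
    then show ?thesis by simp
  qed
  \<comment> \<open>This covers an empty \<open>A'\<close> too: the specification under
    \<open>\<tau>'\<close> is then constantly 0, and all of \<open>color_nbrs H T\<close> counts as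
    lost.\<close>
  have 2: "sum (site_cond H G v \<tau>') ?B = 0"
    by (rule sum.neutral) (auto simp: sc A'_def)
  have "\<bar>sum (site_cond H G v \<tau>) ?B - sum (site_cond H G v \<tau>') ?B\<bar>
      \<le> tv_dist (verts H) (site_cond H G v \<tau>) (site_cond H G v \<tau>')"
    by (rule tv_dist_ge[OF H]) (auto simp: color_nbrs_def)
  also have "\<dots> \<le> influence H G v w" by (rule influence_ge[OF finG H off])
  also have "\<dots> < 1 / card N" by fact
  finally have "card ?B / card (color_nbrs H T) < 1 / card N" by (simp add: 1 2)
  moreover have "card (color_nbrs H T) > 0"
    using False finite_color_nbrs[OF H] by (simp add: card_gt_0_iff)
  ultimately have "real (card N) * card ?B < card (color_nbrs H T)"
    using D0 by (simp add: field_simps)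
  then have "card N * card ?B \<le> card (color_nbrs H T)"
    by (metis less_imp_le of_nat_less_iff of_nat_mult)
  moreover have "card (color_nbrs H T - color_nbrs H {i}) \<le> card ?B"
    using A' finite_color_nbrs[OF H] by (intro card_mono) auto
  ultimately show ?thesis unfolding N_def by (meson mult_le_mono2 order_trans)
qed

subsection \<open>Lower bounds by counting in fibers\<close>

text \<open>\<open>P\<close> is constant on the fibers of \<open>g\<close>, so it selects whole
  fibers and the fiberwise bounds add up. In probabilistic terms, a lower bound for \<open>Q\<close>
  conditioned on \<open>g\<close> is inherited when conditioning on \<open>P\<close>.\<close>

lemma card_fiber_ge:
  fixes r :: real
  assumes fin: "finite \<Omega>"
    and P: "\<And>x y. P x \<Longrightarrow> g y = g x \<Longrightarrow> P y"
    and fiber: "\<And>x. x \<in> \<Omega> \<Longrightarrow> P x \<Longrightarrow>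
      r * card {y\<in>\<Omega>. g y = g x} \<le> card {y\<in>\<Omega>. g y = g x \<and> Q y}"
  shows "r * card {x\<in>\<Omega>. P x} \<le> card {x\<in>\<Omega>. P x \<and> Q x}"
proof -
  define S where "S = {x\<in>\<Omega>. P x}"
  have finS: "finite S" using fin by (simp add: S_def)
  have count: "real (card {x\<in>S. R x}) = (\<Sum>b\<in>g ` S. real (card {x\<in>S. g x = b \<and> R x}))" for R
  proof -
    have "real (card {x\<in>S. R x}) = (\<Sum>x\<in>S. if R x then 1 else 0)"
      using finS by (simp add: sum.If_cases Int_def)
    also have "\<dots> = (\<Sum>b\<in>g ` S. \<Sum>x\<in>{x\<in>S. g x = b}. if R x then 1 else 0)"
      by (rule sum.image_gen[OF finS])
    also have "\<dots> = (\<Sum>b\<in>g ` S. real (card {x\<in>S. g x = b \<and> R x}))"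
      using finS by (intro sum.cong) (simp_all add: sum.If_cases Int_def conj_ac)
    finally show ?thesis .
  qed
  have "r * card S = (\<Sum>b\<in>g ` S. r * card {x\<in>S. g x = b})"
    using count[of "\<lambda>_. True"] by (simp add: sum_distrib_left)
  also have "\<dots> \<le> (\<Sum>b\<in>g ` S. real (card {x\<in>S. g x = b \<and> Q x}))"
  proof (rule sum_mono)
    fix b assume "b \<in> g ` S"
    then obtain x where x: "x \<in> \<Omega>" "P x" "b = g x" by (auto simp: S_def)
    have "{y\<in>S. g y = b \<and> R y} = {y\<in>\<Omega>. g y = g x \<and> R y}" for R
      using x P by (auto simp: S_def)
    from this[of "\<lambda>_. True"] this[of Q] show "r * card {x\<in>S. g x = b} \<le> card {x\<in>S. g x = b \<and> Q x}"
      using fiber[OF x(1,2)] by simp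
  qed
  also have "\<dots> = card {x\<in>S. Q x}" by (rule count[symmetric])
  finally show ?thesis by (simp add: S_def conj_ac)
qed

text \<open>As \<open>G\<close> has no loops, the available colors at \<open>v\<close> do not depend
  on the color of \<open>v\<close>; they parametrize the fiber of the map that forgets this
  color.\<close>

lemma colorings_fiber:
  assumes G: "simple_graph G" and v: "v \<in> verts G" and \<sigma>: "\<sigma> \<in> colorings H G"
  shows "card {\<rho>\<in>colorings H G. \<rho>(v := undefined) = \<sigma>(v := undefined) \<and> \<rho> v \<in> S}
    = card (available H G v \<sigma> \<inter> S)"
proof -
  have "{\<rho>\<in>colorings H G. \<rho>(v := undefined) = \<sigma>(v := undefined) \<and> \<rho> v \<in> S}
    = (\<lambda>c. \<sigma>(v := c)) ` (available H G v \<sigma> \<inter> S)" (is "?L = ?R")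
  proof
    show "?R \<subseteq> ?L" using colorings_update[OF G v \<sigma>] by auto
    show "?L \<subseteq> ?R"
    proof
      fix \<rho> assume \<rho>: "\<rho> \<in> ?L"
      then have eq: "\<rho> = \<sigma>(v := \<rho> v)" by (metis (mono_tags, lifting) fun_upd_triv fun_upd_upd mem_Collect_eq)
      have "\<rho> z = \<sigma> z" if "z \<in> neighborhood G v" for z
        using eq not_in_neighborhood[OF G] that by (metis fun_upd_other)
      then have "\<rho> v \<in> available H G v \<sigma>"
        using \<rho> v by (force simp: available_def neighborhood_def colorings_def PiE_iff)
      then show "\<rho> \<in> ?R" using eq \<rho> by blast
    qed
  qed
  moreover have "inj_on (\<lambda>c. \<sigma>(v := c)) (available H G v \<sigma> \<inter> S)"
    by (rule inj_onI) (metis fun_upd_same)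
  ultimately show ?thesis by (simp add: card_image)
qed

text \<open>Resampling one vertex: given all other colors, \<open>v\<close> is uniform on the
  available ones, and \<open>P\<close> is determined by the other colors.\<close>

lemma card_insensitive_update:
  fixes r :: real
  assumes G: "simple_graph G" and H: "finite (verts H)" and v: "v \<in> verts G"
    and P: "\<And>\<sigma> c. P (\<sigma>(v := c)) = P \<sigma>"
    and av: "\<And>\<sigma>. \<sigma> \<in> colorings H G \<Longrightarrow> P \<sigma> \<Longrightarrow>
      r * card (available H G v \<sigma>) \<le> card (available H G v \<sigma> \<inter> S)"
  shows "r * card {\<sigma>\<in>colorings H G. P \<sigma>} \<le> card {\<sigma>\<in>colorings H G. P \<sigma> \<and> \<sigma> v \<in> S}"
proof (rule card_fiber_ge[where g = "\<lambda>\<sigma>. \<sigma>(v := undefined)"])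
  show "finite (colorings H G)" using G H by (simp add: finite_colorings simple_graph_def)
  show "P \<rho>" if "P \<sigma>" "\<rho>(v := undefined) = \<sigma>(v := undefined)" for \<sigma> \<rho>
    using that P by metis
  show "r * card {\<rho>\<in>colorings H G. \<rho>(v := undefined) = \<sigma>(v := undefined)}
      \<le> card {\<rho>\<in>colorings H G. \<rho>(v := undefined) = \<sigma>(v := undefined) \<and> \<rho> v \<in> S}"
    if "\<sigma> \<in> colorings H G" "P \<sigma>" for \<sigma>
    using av[OF that] colorings_fiber[OF G v that(1), of S] colorings_fiber[OF G v that(1), of UNIV]
    by simp
qed

text \<open>
  The constraints on the vertices of \<open>S\<close> are imposed one vertex at a time; each is satisfied with
  conditional probability at least \<open>1 - 1 / D\<close>, whatever the colors of the other vertices.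
\<close>

lemma card_restrict_vertices:
  assumes G: "simple_graph G" and H: "finite (verts H)" and D: "D > 0"
    and S: "finite S" "S \<subseteq> verts G"
    and deg: "\<And>u. u \<in> S \<Longrightarrow> neighborhood G u \<noteq> {} \<and> card (neighborhood G u) \<le> D"
    and loss: "\<And>T. T \<subseteq> verts H \<Longrightarrow> T \<noteq> {} \<Longrightarrow> card T \<le> D \<Longrightarrow>
      D * card (color_nbrs H T - N) \<le> card (color_nbrs H T)"
    and P: "\<And>\<sigma> u c. u \<in> S \<Longrightarrow> P (\<sigma>(u := c)) = P \<sigma>"
  shows "(1 - 1 / D) ^ card S * card {\<sigma>\<in>colorings H G. P \<sigma>}
    \<le> card {\<sigma>\<in>colorings H G. P \<sigma> \<and> (\<forall>u\<in>S. \<sigma> u \<in> N)}"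
  using S deg P
proof (induction S rule: finite_induct)
  case empty
  then show ?case by simp
next
  case (insert u S)
  let ?P = "\<lambda>\<sigma>. P \<sigma> \<and> (\<forall>u\<in>S. \<sigma> u \<in> N)"
  have IH: "(1 - 1 / D) ^ card S * card {\<sigma>\<in>colorings H G. P \<sigma>} \<le> card {\<sigma>\<in>colorings H G. ?P \<sigma>}"
    using insert by simp
  have step: "(1 - 1 / D) * card {\<sigma>\<in>colorings H G. ?P \<sigma>}
      \<le> card {\<sigma>\<in>colorings H G. ?P \<sigma> \<and> \<sigma> u \<in> N}"
  proof (rule card_insensitive_update[OF G H])
    show "u \<in> verts G" using insert by simp
    show "?P (\<sigma>(u := c)) = ?P \<sigma>" for \<sigma> c
    proof -
      have "P (\<sigma>(u := c)) = P \<sigma>" by (rule insert.prems(3)) simp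
      then show ?thesis using insert.hyps by auto
    qed
    fix \<sigma> assume \<sigma>: "\<sigma> \<in> colorings H G"
    \<comment> \<open>The set \<open>T\<close> of colors around \<open>u\<close> meets the
      requirements of \<open>loss\<close>: it is nonempty because \<open>u\<close> has a neighbor,
      and small because \<open>u\<close> has at most \<open>D\<close> of them.\<close>
    define T where "T = \<sigma> ` neighborhood G u"
    have u: "neighborhood G u \<noteq> {}" "card (neighborhood G u) \<le> D" using insert.prems by auto
    have "T \<subseteq> verts H" using \<sigma> by (auto simp: T_def neighborhood_def colorings_def)
    moreover have "card T \<le> D"
      using u card_image_le[OF finite_neighborhood[OF G]] unfolding T_def by (meson order_trans)
    ultimately have "D * card (color_nbrs H T - N) \<le> card (color_nbrs H T)"
      using u by (intro loss) (auto simp: T_def)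
    then have "real D * card (color_nbrs H T - N) \<le> card (color_nbrs H T)"
      by (metis of_nat_le_iff of_nat_mult)
    then have "real (card (color_nbrs H T - N)) \<le> card (color_nbrs H T) / D"
      using D by (simp add: field_simps)
    moreover have "card (color_nbrs H T) = card (color_nbrs H T \<inter> N) + card (color_nbrs H T - N)"
      using finite_color_nbrs[OF H] by (metis card_Int_Diff)
    ultimately show "(1 - 1 / D) * card (available H G u \<sigma>) \<le> card (available H G u \<sigma> \<inter> N)"
      by (simp add: available_eq T_def algebra_simps add_divide_distrib)
  qed
  have "(1 - 1 / real D) ^ card (insert u S) * card {\<sigma>\<in>colorings H G. P \<sigma>}
      = (1 - 1 / real D) * ((1 - 1 / D) ^ card S * card {\<sigma>\<in>colorings H G. P \<sigma>})"
    using insert by simp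
  also have "\<dots> \<le> (1 - 1 / real D) * card {\<sigma>\<in>colorings H G. ?P \<sigma>}"
    using IH D by (intro mult_left_mono) auto
  also note step
  also have "{\<sigma>\<in>colorings H G. ?P \<sigma> \<and> \<sigma> u \<in> N}
      = {\<sigma>\<in>colorings H G. P \<sigma> \<and> (\<forall>u\<in>insert u S. \<sigma> u \<in> N)}" by auto
  finally show ?case .
qed

text \<open>Once all neighbors of \<open>v\<close> have colors compatible with \<open>i\<close>, the
  color \<open>i\<close> is one of at most \<open>q\<close> available ones.\<close>

lemma card_set_color:
  assumes G: "simple_graph G" and H: "verts H = {1..q}" and v: "v \<in> verts G"
    and i: "i \<in> verts H"
    and P: "\<And>\<sigma> c. P (\<sigma>(v := c)) = P \<sigma>"
  shows "card {\<sigma>\<in>colorings H G. P \<sigma> \<and> (\<forall>u\<in>neighborhood G v. \<sigma> u \<in> color_nbrs H {i})}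
    \<le> real q * card {\<sigma>\<in>colorings H G. P \<sigma> \<and> \<sigma> v = i}"
proof -
  let ?P = "\<lambda>\<sigma>. P \<sigma> \<and> (\<forall>u\<in>neighborhood G v. \<sigma> u \<in> color_nbrs H {i})"
  have q: "q > 0" using i H by auto
  have finH: "finite (verts H)" by (simp add: H)
  have "1 / q * card {\<sigma>\<in>colorings H G. ?P \<sigma>} \<le> card {\<sigma>\<in>colorings H G. ?P \<sigma> \<and> \<sigma> v \<in> {i}}"
  proof (rule card_insensitive_update[OF G finH v])
    show "?P (\<sigma>(v := c)) = ?P \<sigma>" for \<sigma> c
      using P not_in_neighborhood[OF G, of v] by (metis fun_upd_other)
    fix \<sigma> assume "?P \<sigma>"
    then have "i \<in> available H G v \<sigma>"
      using i by (auto simp: available_def color_nbrs_def insert_commute)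
    then have "available H G v \<sigma> \<inter> {i} = {i}" by auto
    moreover have "available H G v \<sigma> \<subseteq> verts H" by (auto simp: available_def)
    then have "card (available H G v \<sigma>) \<le> q"
      using card_mono[OF finH] by (metis H card_atLeastAtMost diff_Suc_1)
    ultimately show "1 / q * card (available H G v \<sigma>) \<le> card (available H G v \<sigma> \<inter> {i})"
      using q by simp
  qed
  also have "\<dots> \<le> card {\<sigma>\<in>colorings H G. P \<sigma> \<and> \<sigma> v = i}"
    using G finH by (intro of_nat_mono card_mono) (auto simp: finite_colorings simple_graph_def)
  finally show ?thesis using q by (simp add: field_simps)
qed

text \<open>Two rounds of the same argument, first for \<open>v\<close>, then for \<open>w\<close>
  given the color of \<open>v\<close>. Each round makes the neighbors compatible at the cost of a
  factor 8 and then sets the color at the cost of a factor \<open>q\<close>.\<close>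

lemma card_color_two_vertices:
  fixes G H :: graph
  assumes G: "simple_graph G" and H: "verts H = {1..q}"
    and v: "v \<in> verts G" "w \<in> verts G" "v \<noteq> w" "w \<notin> neighborhood G v"
    and i: "i \<in> verts H" "j \<in> verts H"
    and D: "D \<ge> 2" "\<And>u. u \<in> verts G \<Longrightarrow> card (neighborhood G u) \<le> D"
    and loss: "\<And>T k. T \<subseteq> verts H \<Longrightarrow> T \<noteq> {} \<Longrightarrow> card T \<le> D \<Longrightarrow> k \<in> verts H \<Longrightarrow>
      D * card (color_nbrs H T - color_nbrs H {k}) \<le> card (color_nbrs H T)"
  shows "card (colorings H G) \<le> 64 * (real q)\<^sup>2 * card {\<sigma>\<in>colorings H G. \<sigma> v = i \<and> \<sigma> w = j}"
proof -
  have finH: "finite (verts H)" by (simp add: H)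
  \<comment> \<open>Bernoulli's inequality with exponent \<open>D\<close> gives only 0, so it is
    applied with \<open>D div 2\<close>, which yields 1 / 2; three such blocks cover every
    \<open>m\<close> up to \<open>D\<close> because \<open>D \<ge> 2\<close>.\<close>
  have pow: "(1 - 1 / real D) ^ m \<ge> 1 / 8" if "m \<le> D" for m
  proof -
    define h where "h = D div 2"
    have "real h * (1 / D) \<le> 1 / 2" using D(1) by (auto simp: h_def field_simps)
    moreover have "1 + real h * (- (1 / D)) \<le> (1 + - (1 / real D)) ^ h"
      by (rule Bernoulli_inequality) (use D(1) in simp)
    ultimately have "(1 - 1 / real D) ^ h \<ge> 1 / 2" by simp
    then have "(1 / 2) ^ 3 \<le> ((1 - 1 / real D) ^ h) ^ 3" by (rule power_mono) simp
    also have "\<dots> = (1 - 1 / real D) ^ (h * 3)" by (rule power_mult[symmetric])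
    also have "\<dots> \<le> (1 - 1 / real D) ^ m"
      using D(1) that by (intro power_decreasing) (auto simp: h_def)
    finally show ?thesis by (simp add: power3_eq_cube)
  qed
  have step: "real (card {\<sigma>\<in>colorings H G. P \<sigma>}) \<le> 8 * real q * card {\<sigma>\<in>colorings H G. P \<sigma> \<and> \<sigma> x = k}"
    if x: "x \<in> verts G" and k: "k \<in> verts H"
      and P: "\<And>\<sigma> u c. u \<in> insert x (neighborhood G x) \<Longrightarrow> P (\<sigma>(u := c)) = P \<sigma>" for x k P
  proof -
    have "1 / 8 * card {\<sigma>\<in>colorings H G. P \<sigma>}
        \<le> (1 - 1 / D) ^ card (neighborhood G x) * card {\<sigma>\<in>colorings H G. P \<sigma>}"
      using pow D(2)[OF x] by (intro mult_right_mono) auto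
    also have "\<dots> \<le> card {\<sigma>\<in>colorings H G. P \<sigma> \<and> (\<forall>u\<in>neighborhood G x. \<sigma> u \<in> color_nbrs H {k})}"
    proof (rule card_restrict_vertices[OF G finH])
      show "neighborhood G x \<subseteq> verts G" by (auto simp: neighborhood_def)
      then show "neighborhood G u \<noteq> {} \<and> card (neighborhood G u) \<le> D" if "u \<in> neighborhood G x" for u
        using neighborhood_sym[OF x that] D(2) that by auto
      show "P (\<sigma>(u := c)) = P \<sigma>" if "u \<in> neighborhood G x" for \<sigma> u c
        by (rule P) (simp add: that)
    qed (use D(1) G k loss finite_neighborhood in auto)
    also have "\<dots> \<le> real q * card {\<sigma>\<in>colorings H G. P \<sigma> \<and> \<sigma> x = k}"
    proof (rule card_set_color[OF G H x k])
      show "P (\<sigma>(x := c)) = P \<sigma>" for \<sigma> c by (rule P) simp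
    qed
    finally show ?thesis by simp
  qed
  have vw: "v \<notin> neighborhood G w" using v neighborhood_sym[of w G v] by blast
  have "real (card (colorings H G)) \<le> 8 * real q * card {\<sigma>\<in>colorings H G. \<sigma> v = i}"
    using step[OF v(1) i(1), of "\<lambda>_. True"] by simp
  \<comment> \<open>The event that \<open>v\<close> has color \<open>i\<close> survives recoloring
    \<open>w\<close> and its neighbors, since \<open>v\<close> is neither \<open>w\<close> nor
    adjacent to it.\<close>
  also have "real (card {\<sigma>\<in>colorings H G. \<sigma> v = i})
      \<le> 8 * real q * card {\<sigma>\<in>colorings H G. \<sigma> v = i \<and> \<sigma> w = j}"
    using vw v(3) by (intro step[OF v(2) i(2)]) auto
  finally show ?thesis by (simp add: power2_eq_square mult_left_mono)
qed

text \<open>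
  If \<open>v\<close> has a single neighbor \<open>u\<close> and \<open>u\<close> has no other neighbor, then \<open>v\<close> and \<open>u\<close> are recolored
  jointly: at most \<open>q\<^sup>2\<close> pairs of colors are possible, and \<open>card (color_nbrs H {i})\<close> of the
  possible pairs give color \<open>i\<close> to \<open>v\<close>.
\<close>

lemma card_set_color_matching:
  assumes G: "simple_graph G" and H: "verts H = {1..q}" and v: "v \<in> verts G"
    and i: "i \<in> verts H"
    and deg: "\<And>u. u \<in> verts G \<Longrightarrow> card (neighborhood G u) \<le> 1"
    and P: "\<And>\<sigma> u c. u \<in> insert v (neighborhood G v) \<Longrightarrow> P (\<sigma>(u := c)) = P \<sigma>"
  shows "real (card (color_nbrs H {i})) * card {\<sigma>\<in>colorings H G. P \<sigma>}
    \<le> (real q)\<^sup>2 * card {\<sigma>\<in>colorings H G. P \<sigma> \<and> \<sigma> v = i}"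
proof -
  define d where "d = card (color_nbrs H {i})"
  have finH: "finite (verts H)" by (simp add: H)
  have finC: "finite (colorings H G)" using G finH by (simp add: finite_colorings simple_graph_def)
  have q: "q > 0" using i H by auto
  have "d \<le> card (verts H)" unfolding d_def
    by (rule card_mono[OF finH]) (auto simp: color_nbrs_def)
  then have dq: "d \<le> q" by (simp add: H)
  show ?thesis
  proof (cases "neighborhood G v = {}")
    case True
    \<comment> \<open>For an isolated \<open>v\<close> the condition on the neighbors is vacuous,
      and \<open>1 / q\<close> is good enough because \<open>d \<le> q\<close>.\<close>
    have "real (card {\<sigma>\<in>colorings H G. P \<sigma> \<and> (\<forall>u\<in>neighborhood G v. \<sigma> u \<in> color_nbrs H {i})})
        \<le> real q * card {\<sigma>\<in>colorings H G. P \<sigma> \<and> \<sigma> v = i}"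
      by (rule card_set_color[OF G H v i]) (rule P, simp)
    then have "real (card {\<sigma>\<in>colorings H G. P \<sigma>}) \<le> real q * card {\<sigma>\<in>colorings H G. P \<sigma> \<and> \<sigma> v = i}"
      by (simp add: True)
    then have "real d * card {\<sigma>\<in>colorings H G. P \<sigma>}
        \<le> real q * (real q * card {\<sigma>\<in>colorings H G. P \<sigma> \<and> \<sigma> v = i})"
      using dq by (intro mult_mono) auto
    then show ?thesis by (simp add: d_def power2_eq_square)
  next
    case False
    then have "card (neighborhood G v) = 1"
      using deg[OF v] finite_neighborhood[OF G, of v] by (metis One_nat_def card_gt_0_iff le_antisym Suc_leI)
    then obtain u where u: "neighborhood G v = {u}" by (auto simp: card_1_singleton_iff)
    have uG: "u \<in> verts G" using u by (auto simp: neighborhood_def)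
    have uv: "u \<noteq> v" using u not_in_neighborhood[OF G, of v] by auto
    have vu: "v \<in> neighborhood G u" using u by (intro neighborhood_sym[OF v]) simp
    have "neighborhood G u = {v}"
      using vu deg[OF uG] finite_neighborhood[OF G, of u]
      by (metis One_nat_def card_le_Suc0_iff_eq is_singletonI' is_singleton_def empty_iff singletonD)
    note nbr = u this
    have eG: "{x, v} \<in> edges G \<longleftrightarrow> x = u" "{x, u} \<in> edges G \<longleftrightarrow> x = v"
      "{v, x} \<in> edges G \<longleftrightarrow> x = u" "{u, x} \<in> edges G \<longleftrightarrow> x = v" if "x \<in> verts G" for x
      using nbr that by (auto simp: neighborhood_def insert_commute)
    define g where "g = (\<lambda>\<sigma>::nat\<Rightarrow>nat. \<sigma>(v := undefined, u := undefined))"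
    have "d / (real q)\<^sup>2 * card {\<sigma>\<in>colorings H G. P \<sigma>} \<le> card {\<sigma>\<in>colorings H G. P \<sigma> \<and> \<sigma> v = i}"
    proof (rule card_fiber_ge[where g = g, OF finC])
      show "P \<rho>" if "P \<sigma>" "g \<rho> = g \<sigma>" for \<sigma> \<rho>
      proof -
        have "P (g \<sigma>) = P \<sigma>" for \<sigma>
        proof -
          have "P (g \<sigma>) = P (\<sigma>(v := undefined))" unfolding g_def by (rule P) (simp add: nbr)
          also have "\<dots> = P \<sigma>" by (rule P) simp
          finally show ?thesis .
        qed
        then show ?thesis using that by metis
      qed
      fix \<sigma> assume \<sigma>: "\<sigma> \<in> colorings H G"
      have "{\<rho>\<in>colorings H G. g \<rho> = g \<sigma>} \<subseteq> (\<lambda>(a, b). \<sigma>(v := a, u := b)) ` (verts H \<times> verts H)"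
      proof
        fix \<rho> assume \<rho>: "\<rho> \<in> {\<rho>\<in>colorings H G. g \<rho> = g \<sigma>}"
        have "\<rho> = \<sigma>(v := \<rho> v, u := \<rho> u)"
        proof
          fix z
          have "g \<rho> z = g \<sigma> z" using \<rho> by simp
          then show "\<rho> z = (\<sigma>(v := \<rho> v, u := \<rho> u)) z" by (simp add: g_def split: if_splits)
        qed
        moreover have "\<rho> v \<in> verts H" "\<rho> u \<in> verts H" using \<rho> v uG by (auto simp: colorings_def)
        ultimately show "\<rho> \<in> (\<lambda>(a, b). \<sigma>(v := a, u := b)) ` (verts H \<times> verts H)"
          by (intro image_eqI[of _ _ "(\<rho> v, \<rho> u)"]) auto
      qed
      then have "card {\<rho>\<in>colorings H G. g \<rho> = g \<sigma>} \<le> card (verts H \<times> verts H)"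
        using finH by (intro surj_card_le) auto
      then have 1: "card {\<rho>\<in>colorings H G. g \<rho> = g \<sigma>} \<le> q\<^sup>2"
        by (simp add: H power2_eq_square)
      \<comment> \<open>\<open>v\<close> and \<open>u\<close> form a component of \<open>G\<close>,
        so the only edge constraint affected is the one between them.\<close>
      have "\<sigma>(v := i, u := c) \<in> colorings H G" if c: "c \<in> color_nbrs H {i}" for c
      proof -
        have c': "c \<in> verts H" "{c, i} \<in> edges H" "{i, c} \<in> edges H"
          using c by (auto simp: color_nbrs_def insert_commute)
        have "\<sigma>(v := i, u := c) \<in> verts G \<rightarrow>\<^sub>E verts H"
          using \<sigma> v uG i c' by (auto simp: colorings_def PiE_iff extensional_def)
        moreover have "{(\<sigma>(v := i, u := c)) a, (\<sigma>(v := i, u := c)) b} \<in> edges H"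
          if ab: "a \<in> verts G" "b \<in> verts G" "{a, b} \<in> edges G" for a b
        proof (cases "a \<in> {u, v} \<or> b \<in> {u, v}")
          case True
          then have "a = u \<and> b = v \<or> a = v \<and> b = u" using ab eG by blast
          then show ?thesis using c' uv by auto
        next
          case False
          then show ?thesis using ab \<sigma> by (auto simp: colorings_def)
        qed
        ultimately show ?thesis by (simp add: colorings_def)
      qed
      then have "(\<lambda>c. \<sigma>(v := i, u := c)) ` color_nbrs H {i}
          \<subseteq> {\<rho>\<in>colorings H G. g \<rho> = g \<sigma> \<and> \<rho> v = i}"
        using uv by (auto simp: g_def fun_upd_def)
      moreover have "inj_on (\<lambda>c. \<sigma>(v := i, u := c)) (color_nbrs H {i})"
        by (rule inj_onI) (metis fun_upd_same)
      ultimately have "d \<le> card {\<rho>\<in>colorings H G. g \<rho> = g \<sigma> \<and> \<rho> v = i}"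
        unfolding d_def using finC by (intro card_inj_on_le) auto
      moreover have "d / (real q)\<^sup>2 * card {\<rho>\<in>colorings H G. g \<rho> = g \<sigma>} \<le> d / (real q)\<^sup>2 * real (q\<^sup>2)"
        using 1 by (intro mult_left_mono of_nat_mono) auto
      ultimately show "d / (real q)\<^sup>2 * card {\<rho>\<in>colorings H G. g \<rho> = g \<sigma>}
          \<le> card {\<rho>\<in>colorings H G. g \<rho> = g \<sigma> \<and> \<rho> v = i}"
        using q by simp
    qed
    then show ?thesis using q by (simp add: d_def field_simps)
  qed
qed

text \<open>
  Non-edges between vertices of small degree would have little weight; but a vertex of degree less
  than \<open>q / 2\<close> has more than \<open>q / 2\<close> non-neighbors, so either there are many such vertices, or one
  of them has many non-neighbors of large degree.
\<close>

lemma sum_degree_product_nonedges: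
  fixes N :: "'a \<Rightarrow> 'a set"
  assumes fin: "finite V" and N: "\<And>i. i \<in> V \<Longrightarrow> N i \<subseteq> V \<and> N i \<noteq> {}"
    and ne: "a \<in> V" "b \<in> V" "b \<notin> N a"
  shows "(real (card V))\<^sup>2 \<le> 8 * (\<Sum>i\<in>V. \<Sum>j\<in>V - N i. real (card (N i)) * card (N j))"
proof -
  define q where "q = real (card V)"
  define d where "d i = real (card (N i))" for i
  define B where "B = {i\<in>V. d i < q / 2}"
  have finN: "finite (N i)" if "i \<in> V" for i using N that fin finite_subset by blast
  have d1: "d i \<ge> 1" if "i \<in> V" for i
    using N that finN[OF that] by (simp add: d_def Suc_le_eq card_gt_0_iff)
  have co: "real (card (V - N i)) = q - d i" if "i \<in> V" for i
    using N[OF that] fin finN[OF that]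
    by (simp add: q_def d_def card_Diff_subset of_nat_diff[OF card_mono])
  have q0: "q \<ge> 0" by (simp add: q_def)
  have row: "(\<Sum>j\<in>V - N i. d i * d j) \<le> (\<Sum>i\<in>V. \<Sum>j\<in>V - N i. d i * d j)" if "i \<in> V" for i
    using that fin by (intro member_le_sum[where f = "\<lambda>i. \<Sum>j\<in>V - N i. d i * d j"])
      (auto intro!: sum_nonneg simp: d_def)
  have "q\<^sup>2 \<le> 8 * (\<Sum>i\<in>V. \<Sum>j\<in>V - N i. d i * d j)"
  proof -
    consider "B = {}" | "B \<noteq> {}" "card B < q / 4" | "card B \<ge> q / 4" by linarith
    then show ?thesis
    proof cases
      case 1
      \<comment> \<open>No vertex has small degree: the pair \<open>a\<close>, \<open>b\<close>
        alone contributes q^2 / 4.\<close>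
      then have "d a \<ge> q / 2" "d b \<ge> q / 2" using ne by (auto simp: B_def not_less)
      then have "q / 2 * (q / 2) \<le> d a * d b" using q0 by (intro mult_mono) auto
      also have "\<dots> \<le> (\<Sum>j\<in>V - N a. d a * d j)"
        using ne fin by (intro member_le_sum[where f = "\<lambda>j. d a * d j"]) (auto simp: d_def)
      also note row[OF ne(1)]
      finally have "q\<^sup>2 / 4 \<le> (\<Sum>i\<in>V. \<Sum>j\<in>V - N i. d i * d j)" by (simp add: power2_eq_square)
      then show ?thesis using zero_le_power2[of q] by linarith
    next
      case 2
      \<comment> \<open>More than \<open>q / 2\<close> non-neighbors of \<open>i\<close>, fewer than
        \<open>q / 4\<close> of them in \<open>B\<close>: at least \<open>q / 4\<close> have degree
        \<open>q / 2\<close> or more.\<close>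
      then obtain i where i: "i \<in> V" "d i < q / 2" by (auto simp: B_def)
      have "card (V - N i) \<le> card (V - N i - B) + card B"
        proof -
          have "card (V - N i) \<le> card ((V - N i - B) \<union> B)"
            using fin by (intro card_mono) (auto simp: B_def)
          also have "\<dots> \<le> card (V - N i - B) + card B" by (rule card_Un_le)
          finally show ?thesis .
        qed
      then have "real (card (V - N i)) \<le> real (card (V - N i - B)) + card B" by linarith
      then have "q / 4 \<le> card (V - N i - B)" using co[OF i(1)] i 2 by linarith
      then have "q / 4 * (q / 2) \<le> card (V - N i - B) * (q / 2)" using q0 by (intro mult_right_mono) auto
      also have "\<dots> = (\<Sum>j\<in>V - N i - B. 1 * (q / 2))" by simp
      also have "\<dots> \<le> (\<Sum>j\<in>V - N i - B. d i * d j)"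
        using d1[OF i(1)] q0 by (intro sum_mono mult_mono) (auto simp: B_def)
      also have "\<dots> \<le> (\<Sum>j\<in>V - N i. d i * d j)"
        using fin by (intro sum_mono2) (auto simp: d_def)
      also note row[OF i(1)]
      finally show ?thesis by (simp add: power2_eq_square)
    next
      case 3
      \<comment> \<open>At least \<open>q / 4\<close> rows, each with more than \<open>q / 2\<close>
        non-neighbors; every product of degrees is at least 1.\<close>
      have "q / 4 * (q / 2) \<le> card B * (q / 2)" using 3 q0 by (intro mult_right_mono) auto
      also have "\<dots> = (\<Sum>i\<in>B. q / 2)" by simp
      also have "\<dots> \<le> (\<Sum>i\<in>B. \<Sum>j\<in>V - N i. 1 * 1)"
        using co by (intro sum_mono) (auto simp: B_def)
      also have "\<dots> \<le> (\<Sum>i\<in>B. \<Sum>j\<in>V - N i. d i * d j)"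
        using d1 by (intro sum_mono mult_mono) (auto simp: B_def d_def)
      also have "\<dots> \<le> (\<Sum>i\<in>V. \<Sum>j\<in>V - N i. d i * d j)"
        using fin by (intro sum_mono2) (auto simp: B_def d_def intro!: sum_nonneg)
      finally show ?thesis by (simp add: power2_eq_square)
    qed
  qed
  then show ?thesis by (simp add: q_def d_def)
qed

section \<open>Incompatible colors on nonadjacent vertices\<close>

text \<open>The first edge of a path from \<open>i\<close> to another color leads to a neighbor. A
  single color without a loop is connected but has none, hence \<open>q \<ge> 2\<close>.\<close>

lemma color_nbrs_nonempty:
  assumes H: "constraint_graph q H" and q: "q \<ge> 2" and i: "i \<in> verts H"
  shows "color_nbrs H {i} \<noteq> {}"
proof -
  have V: "verts H = {1..q}" and E: "edges H \<subseteq> edges (looped_complete q)" and c: "connected_graph H"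
    using H by (auto simp: constraint_graph_def)
  define j where "j = (if i = 1 then 2 else 1 :: nat)"
  have j: "j \<in> verts H" "i \<noteq> j" using q by (auto simp: j_def V)
  have "(i, j) \<in> {(a, b). {a, b} \<in> edges H}\<^sup>*" using c i j by (simp add: connected_graph_def)
  then obtain k where "(i, k) \<in> {(a, b). {a, b} \<in> edges H}"
    using j(2) by (meson converse_rtranclE)
  then have "{i, k} \<in> edges H" by simp
  moreover have "e \<subseteq> {1..q}" if "e \<in> edges H" for e
    using E that by (auto simp: looped_complete_def)
  then have "k \<in> verts H" using \<open>{i, k} \<in> edges H\<close> unfolding V by blast
  ultimately show ?thesis by (auto simp: color_nbrs_def insert_commute)
qed

lemma exists_incompatible_pair:
  assumes "constraint_graph q H" "H \<noteq> looped_complete q"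
  shows "\<exists>a\<in>verts H. \<exists>b\<in>verts H. {a, b} \<notin> edges H"
proof (rule ccontr)
  assume "\<not> ?thesis"
  then have "edges H = edges (looped_complete q)"
    using assms by (auto simp: constraint_graph_def looped_complete_def)
  then show False using assms by (simp add: constraint_graph_def looped_complete_def)
qed

lemma card_incompatible_ge:
  assumes H: "constraint_graph q H" "H \<noteq> looped_complete q"
    and G: "simple_graph G" and col: "colorable H G" and dob: "dobrushin H G"
    and v: "v \<in> verts G" "w \<in> verts G" "v \<noteq> w" "{v, w} \<notin> edges G"
  shows "card (colorings H G) \<le> 64 * (real q)\<^sup>2 * card {\<sigma>\<in>colorings H G. {\<sigma> v, \<sigma> w} \<notin> edges H}"
proof -
  have V: "verts H = {1..q}" using H by (simp add: constraint_graph_def)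
  have finH: "finite (verts H)" by (simp add: V)
  have finG: "finite (verts G)" using G by (simp add: simple_graph_def)
  have finC: "finite (colorings H G)" using finH finG by (simp add: finite_colorings)
  obtain a b where ab: "a \<in> verts H" "b \<in> verts H" "{a, b} \<notin> edges H"
    using exists_incompatible_pair[OF H] by blast
  then have q1: "q \<ge> 1" by (auto simp: V)
  have wv: "w \<notin> neighborhood G v" "v \<notin> neighborhood G w"
    using v by (auto simp: neighborhood_def insert_commute)
  define D where "D = Max ((\<lambda>u. card (neighborhood G u)) ` verts G)"
  have deg: "card (neighborhood G u) \<le> D" if "u \<in> verts G" for u
    unfolding D_def using finG that by (intro Max_ge) auto
  have "D \<in> (\<lambda>u. card (neighborhood G u)) ` verts G"
    unfolding D_def using finG v by (intro Max_in) auto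
  then obtain u0 where u0: "u0 \<in> verts G" "D = card (neighborhood G u0)" by auto
  \<comment> \<open>A single color is treated separately because it may have no neighbor in
    \<open>H\<close>.\<close>
  consider "D \<ge> 2" | "D \<le> 1" "q = 1" | "D \<le> 1" "q \<ge> 2" using q1 by linarith
  then show ?thesis
  proof cases
    case 1
    have "card (colorings H G) \<le> 64 * (real q)\<^sup>2 * card {\<sigma>\<in>colorings H G. \<sigma> v = a \<and> \<sigma> w = b}"
    proof (rule card_color_two_vertices[OF G V v(1-3) wv(1) ab(1,2) 1 deg])
      \<comment> \<open>The Dobrushin condition is used at \<open>u0\<close>, whose degree is the
        maximum \<open>D\<close>, so that all color sets of size up to \<open>D\<close> are
        covered.\<close>
      show "D * card (color_nbrs H T - color_nbrs H {k}) \<le> card (color_nbrs H T)"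
        if "T \<subseteq> verts H" "T \<noteq> {}" "card T \<le> D" "k \<in> verts H" for T k
        using dobrushin_color_loss[OF G finH col dob u0(1), of T k] that u0(2) by simp
    qed
    also have "\<dots> \<le> 64 * (real q)\<^sup>2 * card {\<sigma>\<in>colorings H G. {\<sigma> v, \<sigma> w} \<notin> edges H}"
      using ab finC by (intro mult_left_mono of_nat_mono card_mono) auto
    finally show ?thesis .
  next
    case 2
    \<comment> \<open>The incompatible pair must be the only color with itself, so every coloring is
      a witness.\<close>
    have "{\<sigma>\<in>colorings H G. {\<sigma> v, \<sigma> w} \<notin> edges H} = colorings H G"
    proof -
      have "\<sigma> v = a \<and> \<sigma> w = b" if "\<sigma> \<in> colorings H G" for \<sigma>
      proof -
        have "\<sigma> v \<in> {1..q}" "\<sigma> w \<in> {1..q}" using that v V by (auto simp: colorings_def)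
        then show ?thesis using ab 2 V by auto
      qed
      then show ?thesis using ab by auto
    qed
    then show ?thesis using 2 by simp
  next
    case 3
    define d where "d i = real (card (color_nbrs H {i}))" for i
    define I where "I = (SIGMA i:verts H. verts H - color_nbrs H {i})"
    define c where "c i j = real (card {\<sigma>\<in>colorings H G. \<sigma> v = i \<and> \<sigma> w = j})" for i j
    have deg1: "card (neighborhood G u) \<le> 1" if "u \<in> verts G" for u
      using deg[OF that] 3 by simp
    \<comment> \<open>Color \<open>v\<close> first, then \<open>w\<close>: the conditional
      probabilities are at least \<open>d i / q^2\<close> and \<open>d j / q^2\<close>.\<close>
    have pair: "d i * d j * card (colorings H G) \<le> (real q)^4 * c i j"
      if ij: "i \<in> verts H" "j \<in> verts H" for i j
    proof -
      have 1: "d i * card (colorings H G) \<le> (real q)\<^sup>2 * card {\<sigma>\<in>colorings H G. \<sigma> v = i}"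
        using card_set_color_matching[OF G V v(1) ij(1), of "\<lambda>_. True"] deg1 by (simp add: d_def)
      have 2: "d j * card {\<sigma>\<in>colorings H G. \<sigma> v = i} \<le> (real q)\<^sup>2 * c i j"
        unfolding d_def c_def
        by (rule card_set_color_matching[OF G V v(2) ij(2), of "\<lambda>\<sigma>. \<sigma> v = i"])
          (use deg1 wv(2) v(3) in auto)
      have "d j * (d i * card (colorings H G)) \<le> d j * ((real q)\<^sup>2 * card {\<sigma>\<in>colorings H G. \<sigma> v = i})"
        using 1 by (intro mult_left_mono) (auto simp: d_def)
      also have "\<dots> = (real q)\<^sup>2 * (d j * card {\<sigma>\<in>colorings H G. \<sigma> v = i})" by simp
      also have "\<dots> \<le> (real q)\<^sup>2 * ((real q)\<^sup>2 * c i j)" using 2 by (intro mult_left_mono) auto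
      also have "\<dots> = (real q)^4 * c i j" by (simp add: power4_eq_xxxx power2_eq_square)
      finally show ?thesis by (simp add: mult_ac)
    qed
    have finI: "finite I" using finH by (simp add: I_def)
    have mem: "j \<in> color_nbrs H {i} \<longleftrightarrow> {i, j} \<in> edges H" if "j \<in> verts H" for i j
      using that by (auto simp: color_nbrs_def insert_commute)
    \<comment> \<open>Distinct pairs of colors give disjoint events, so their counts add up inside
      the set of witnesses.\<close>
    have sub: "(\<Union>(i, j)\<in>I. {\<sigma>\<in>colorings H G. \<sigma> v = i \<and> \<sigma> w = j})
        \<subseteq> {\<sigma>\<in>colorings H G. {\<sigma> v, \<sigma> w} \<notin> edges H}"
      using mem by (auto simp: I_def)
    have "(\<Sum>(i, j)\<in>I. c i j) = real (\<Sum>p\<in>I. card {\<sigma>\<in>colorings H G. \<sigma> v = fst p \<and> \<sigma> w = snd p})"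
      by (simp add: c_def case_prod_unfold)
    also have "(\<Sum>p\<in>I. card {\<sigma>\<in>colorings H G. \<sigma> v = fst p \<and> \<sigma> w = snd p})
        = card (\<Union>p\<in>I. {\<sigma>\<in>colorings H G. \<sigma> v = fst p \<and> \<sigma> w = snd p})"
      using finI finC by (intro card_UN_disjoint[symmetric]) auto
    also have "\<dots> \<le> card {\<sigma>\<in>colorings H G. {\<sigma> v, \<sigma> w} \<notin> edges H}"
      using sub finC by (intro card_mono) (auto simp: case_prod_unfold)
    finally have sum_c: "(\<Sum>(i, j)\<in>I. c i j) \<le> card {\<sigma>\<in>colorings H G. {\<sigma> v, \<sigma> w} \<notin> edges H}"
      by simp
    have "(real (card (verts H)))\<^sup>2
        \<le> 8 * (\<Sum>i\<in>verts H. \<Sum>j\<in>verts H - color_nbrs H {i}. d i * d j)"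
      unfolding d_def
    proof (rule sum_degree_product_nonedges[OF finH _ ab(1,2)])
      show "color_nbrs H {i} \<subseteq> verts H \<and> color_nbrs H {i} \<noteq> {}" if "i \<in> verts H" for i
        using color_nbrs_nonempty[OF H(1) 3(2) that] by (auto simp: color_nbrs_def)
      show "b \<notin> color_nbrs H {a}" using ab mem by simp
    qed
    also have "(\<Sum>i\<in>verts H. \<Sum>j\<in>verts H - color_nbrs H {i}. d i * d j) = (\<Sum>(i, j)\<in>I. d i * d j)"
      unfolding I_def using finH by (intro sum.Sigma) auto
    finally have q2: "(real q)\<^sup>2 \<le> 8 * (\<Sum>(i, j)\<in>I. d i * d j)" by (simp add: V)
    \<comment> \<open>Summing \<open>pair\<close> over \<open>I\<close> turns the weight bound into
      a bound on the number of witnesses; one factor q^2 cancels at the end.\<close>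
    have "(real q)\<^sup>2 * card (colorings H G) \<le> 8 * (\<Sum>(i, j)\<in>I. d i * d j) * card (colorings H G)"
      using q2 by (intro mult_right_mono) auto
    also have "\<dots> = 8 * (\<Sum>(i, j)\<in>I. d i * d j * card (colorings H G))"
      by (simp add: sum_distrib_right case_prod_unfold)
    also have "\<dots> \<le> 8 * (\<Sum>(i, j)\<in>I. (real q)^4 * c i j)"
      using pair by (intro mult_left_mono sum_mono) (auto simp: I_def)
    also have "\<dots> = 8 * (real q)^4 * (\<Sum>(i, j)\<in>I. c i j)"
      by (simp add: sum_distrib_left case_prod_unfold mult_ac)
    also have "\<dots> \<le> 8 * (real q)^4 * card {\<sigma>\<in>colorings H G. {\<sigma> v, \<sigma> w} \<notin> edges H}"
      using sum_c by (intro mult_left_mono) auto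
    also have "\<dots> = (real q)\<^sup>2 * (8 * (real q)\<^sup>2 * card {\<sigma>\<in>colorings H G. {\<sigma> v, \<sigma> w} \<notin> edges H})"
      by (simp add: power4_eq_xxxx power2_eq_square)
    finally have "card (colorings H G) \<le> 8 * (real q)\<^sup>2 * card {\<sigma>\<in>colorings H G. {\<sigma> v, \<sigma> w} \<notin> edges H}"
      using q1 by simp
    also have "\<dots> \<le> 64 * (real q)\<^sup>2 * card {\<sigma>\<in>colorings H G. {\<sigma> v, \<sigma> w} \<notin> edges H}"
      by (intro mult_right_mono) auto
    finally show ?thesis .
  qed
qed

subsection \<open>The algorithm\<close>

text \<open>A Hoare triple for total correctness with a time budget; the rules below work backwards
  from the postcondition \<open>Q\<close>.\<close>

definition terminates :: "learning_input \<Rightarrow> prog \<Rightarrow> state \<Rightarrow> nat \<Rightarrow> (state \<Rightarrow> bool) \<Rightarrow> bool" where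
  "terminates inp c s T Q \<longleftrightarrow> (\<exists>t s'. exec inp c s t s' \<and> t \<le> T \<and> Q s')"

lemma terminates_Const: "Q (assign x k s) \<Longrightarrow> terminates inp (Const x k) s 1 Q"
  unfolding terminates_def using exec.Const by blast

lemma terminates_Add: "Q (assign x (mem s y + mem s z) s) \<Longrightarrow> terminates inp (Add x y z) s 1 Q"
  unfolding terminates_def using exec.Add by blast

lemma terminates_Read_Constraint:
  "Q (assign x (constraint_entry inp (mem s y) (mem s z)) s) \<Longrightarrow>
    terminates inp (Read_Constraint x y z) s 1 Q"
  unfolding terminates_def using exec.Read_Constraint by blast

lemma terminates_Read_Sample:
  "Q (assign x (sample_entry inp (mem s y) (mem s z)) s) \<Longrightarrow>
    terminates inp (Read_Sample x y z) s 1 Q"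
  unfolding terminates_def using exec.Read_Sample by blast

lemma terminates_Write_Out:
  "Q (s\<lparr>out := (out s)(mem s y := (out s (mem s y))(mem s z := mem s x))\<rparr>) \<Longrightarrow>
    terminates inp (Write_Out y z x) s 1 Q"
  unfolding terminates_def using exec.Write_Out by blast

lemma terminates_Seq:
  assumes "terminates inp c1 s T1 (\<lambda>s'. terminates inp c2 s' T2 Q)"
  shows "terminates inp (Seq c1 c2) s (T1 + T2) Q"
  using assms unfolding terminates_def by (meson add_mono exec.Seq)

lemma terminates_If_Skip:
  assumes "\<not> mem s x < mem s y \<Longrightarrow> terminates inp c s T Q"
    and "mem s x < mem s y \<Longrightarrow> Q s" and "T \<ge> 1"
  shows "terminates inp (If_Less x y Skip c) s (Suc T) Q"
proof (cases "mem s x < mem s y")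
  case True
  then have "exec inp (If_Less x y Skip c) s (Suc 1) s" by (intro exec.If_True exec.Skip)
  then show ?thesis unfolding terminates_def using True assms by auto
next
  case False
  then obtain t s' where "exec inp c s t s'" "t \<le> T" "Q s'"
    using assms unfolding terminates_def by blast
  then show ?thesis unfolding terminates_def using False exec.If_False by (meson Suc_le_mono)
qed

lemma terminates_mono:
  assumes "terminates inp c s T Q" "T \<le> T'" "\<And>s. Q s \<Longrightarrow> Q' s"
  shows "terminates inp c s T' Q'"
  using assms unfolding terminates_def by (meson order_trans)

text \<open>The invariant is indexed by the counter in \<open>x\<close>. Each iteration pays one
  unit for its test, and the final 1 is the failing test.\<close>

lemma terminates_While:
  assumes guard: "\<And>k s. k \<le> m \<Longrightarrow> I k s \<Longrightarrow> mem s x = k \<and> mem s y = m"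
    and body: "\<And>k s. k < m \<Longrightarrow> I k s \<Longrightarrow> terminates inp c s T (I (Suc k))"
    and "I k s" "k \<le> m"
  shows "terminates inp (While_Less x y c) s ((m - k) * Suc T + 1) (I m)"
  using assms(3,4)
proof (induction "m - k" arbitrary: k s)
  case 0
  then have "mem s x = m \<and> mem s y = m" using guard[of k s] by simp
  then have "exec inp (While_Less x y c) s 1 s" by (intro exec.While_False) simp
  then show ?case unfolding terminates_def using 0 by auto
next
  case (Suc d)
  then have k: "k < m" by simp
  obtain t s' where t: "exec inp c s t s'" "t \<le> T" "I (Suc k) s'"
    using body[OF k Suc.prems(1)] unfolding terminates_def by blast
  have "terminates inp (While_Less x y c) s' ((m - Suc k) * Suc T + 1) (I m)"
    using Suc t k by (intro Suc.hyps) auto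
  then obtain t' s'' where t': "exec inp (While_Less x y c) s' t' s''"
    "t' \<le> (m - Suc k) * Suc T + 1" "I m s''"
    unfolding terminates_def by blast
  have "exec inp (While_Less x y c) s (Suc (t + t')) s''"
    using guard[OF less_imp_le[OF k] Suc.prems(1)] k t t' by (intro exec.While_True) auto
  moreover have "m - k = Suc (m - Suc k)" using k by simp
  then have "Suc (t + t') \<le> (m - k) * Suc T + 1"
    using t t' by simp
  ultimately show ?case unfolding terminates_def using t' by blast
qed

section \<open>The program and its loop invariants\<close>

definition compatible_samples :: "learning_input \<Rightarrow> nat \<Rightarrow> nat \<Rightarrow> nat \<Rightarrow> bool" where
  "compatible_samples inp v w L \<longleftrightarrow>
     (\<forall>l<L. constraint_entry inp (sample_entry inp l v) (sample_entry inp l w) > 0)"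

text \<open>
  Registers: 0--2 hold the sizes of the input, 3 and 4 the pair of vertices, 5 the sample index,
  6 the verdict on the pair, 9 is never written and holds 0, 10 holds 1.
\<close>

definition test_sample :: prog where
  "test_sample =
     Seq (Read_Sample 7 5 3) (Seq (Read_Sample 8 5 4) (Seq (Read_Constraint 7 7 8)
       (Seq (If_Less 9 7 Skip (Const 6 0)) (Add 5 5 10))))"

definition test_pair :: prog where
  "test_pair =
     Seq (Const 6 1) (Seq (Const 5 0) (Seq (While_Less 5 2 test_sample)
       (Seq (Write_Out 3 4 6) (Add 4 4 10))))"

text \<open>The bound of the inner loop is register 3 itself, so only vertices below the current one
  are paired with it and each pair is tested once.\<close>

definition test_vertex :: prog where
  "test_vertex = Seq (Const 4 0) (Seq (While_Less 4 3 test_pair) (Add 3 3 10))"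

definition structure_learn :: prog where
  "structure_learn = Seq (Const 10 1) (While_Less 3 1 test_vertex)"

definition frame :: "nat \<Rightarrow> nat \<Rightarrow> state \<Rightarrow> bool" where
  "frame n L s \<longleftrightarrow> mem s 1 = n \<and> mem s 2 = L \<and> mem s 9 = 0 \<and> mem s 10 = 1"

definition pair_inv ::
    "learning_input \<Rightarrow> nat \<Rightarrow> nat \<Rightarrow> nat \<Rightarrow> nat \<Rightarrow> (nat \<Rightarrow> nat \<Rightarrow> nat) \<Rightarrow> nat \<Rightarrow> state \<Rightarrow> bool" where
  "pair_inv inp n L v w z l s \<longleftrightarrow> frame n L s \<and> mem s 3 = v \<and> mem s 4 = w \<and> mem s 5 = l \<and>
     out s = z \<and> (mem s 6 > 0 \<longleftrightarrow> compatible_samples inp v w l)"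

definition vertex_inv :: "learning_input \<Rightarrow> nat \<Rightarrow> nat \<Rightarrow> nat \<Rightarrow> nat \<Rightarrow> state \<Rightarrow> bool" where
  "vertex_inv inp n L v w s \<longleftrightarrow> frame n L s \<and> mem s 3 = v \<and> mem s 4 = w \<and>
     (\<forall>a b. out s a b > 0 \<longleftrightarrow>
        (b < a \<and> a < v \<or> a = v \<and> b < w) \<and> compatible_samples inp a b L)"

definition graph_inv :: "learning_input \<Rightarrow> nat \<Rightarrow> nat \<Rightarrow> nat \<Rightarrow> state \<Rightarrow> bool" where
  "graph_inv inp n L v s \<longleftrightarrow> frame n L s \<and> mem s 3 = v \<and>
     (\<forall>a b. out s a b > 0 \<longleftrightarrow> b < a \<and> a < v \<and> compatible_samples inp a b L)"

lemma test_sample: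
  assumes "pair_inv inp n L v w z l s"
  shows "terminates inp test_sample s 6 (pair_inv inp n L v w z (Suc l))"
proof -
  \<comment> \<open>The budget is written in the shape in which the rules compose it.\<close>
  have "terminates inp test_sample s (1 + (1 + (1 + (Suc 1 + 1)))) (pair_inv inp n L v w z (Suc l))"
    unfolding test_sample_def
    apply (rule terminates_Seq, rule terminates_Read_Sample)
    apply (rule terminates_Seq, rule terminates_Read_Sample)
    apply (rule terminates_Seq, rule terminates_Read_Constraint)
    apply (rule terminates_Seq, rule terminates_If_Skip)
      apply (rule terminates_Const, rule terminates_Add)
    using assms
      apply (auto simp: pair_inv_def frame_def assign_def compatible_samples_def)[1]
     apply (rule terminates_Add)
    using assms
    by (auto simp: pair_inv_def frame_def assign_def compatible_samples_def less_Suc_eq)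
  then show ?thesis by (elim terminates_mono) auto
qed

lemma test_pair:
  assumes "vertex_inv inp n L v w s"
  shows "terminates inp test_pair s (7 * L + 5) (vertex_inv inp n L v (Suc w))"
proof -
  have "terminates inp test_pair s (1 + (1 + (((L - 0) * Suc 6 + 1) + (1 + 1))))
      (vertex_inv inp n L v (Suc w))"
    unfolding test_pair_def
    apply (rule terminates_Seq, rule terminates_Const)
    apply (rule terminates_Seq, rule terminates_Const)
    apply (rule terminates_Seq)
    apply (rule terminates_mono[OF terminates_While[where m = L and k = 0 and
            I = "pair_inv inp n L v w (out s)"]])
         apply (simp add: pair_inv_def frame_def)
        apply (erule test_sample)
    using assms
       apply (simp add: pair_inv_def vertex_inv_def frame_def assign_def compatible_samples_def)
      apply simp
     apply simp
    apply (rule terminates_Seq, rule terminates_Write_Out)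
    by (rule terminates_Add, use assms in
      \<open>auto simp: pair_inv_def vertex_inv_def frame_def assign_def\<close>)
  then show ?thesis by (elim terminates_mono) auto
qed

lemma test_vertex:
  assumes "graph_inv inp n L v s" "v < n"
  shows "terminates inp test_vertex s (n * (7 * L + 6) + 3) (graph_inv inp n L (Suc v))"
proof -
  have "terminates inp test_vertex s (1 + (((v - 0) * Suc (7 * L + 5) + 1) + 1))
      (graph_inv inp n L (Suc v))"
    unfolding test_vertex_def
    apply (rule terminates_Seq, rule terminates_Const)
    apply (rule terminates_Seq)
    apply (rule terminates_mono[OF terminates_While[where m = v and k = 0 and
            I = "vertex_inv inp n L v"]])
         apply (simp add: vertex_inv_def)
        apply (erule test_pair)
    using assms
       apply (auto simp: graph_inv_def vertex_inv_def frame_def assign_def)[1]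
      apply simp
     apply simp
    by (rule terminates_Add, use assms in
      \<open>auto simp: graph_inv_def vertex_inv_def frame_def assign_def less_Suc_eq\<close>)
  moreover have "v * (7 * L + 6) \<le> n * (7 * L + 6)" using assms by (intro mult_right_mono) auto
  ultimately show ?thesis
    by (elim terminates_mono) (auto simp: algebra_simps)
qed

lemma structure_learn:
  assumes "n = num_verts inp" "L = num_samples inp"
  shows "terminates inp structure_learn (initial_state inp) (n * (n * (7 * L + 6) + 4) + 2)
    (\<lambda>s. \<forall>a b. out s a b > 0 \<longleftrightarrow> b < a \<and> a < n \<and> compatible_samples inp a b L)"
proof -
  have "terminates inp structure_learn (initial_state inp)
      (1 + ((n - 0) * Suc (n * (7 * L + 6) + 3) + 1)) (graph_inv inp n L n)"
    unfolding structure_learn_def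
    apply (rule terminates_Seq, rule terminates_Const)
    apply (rule terminates_While[where I = "graph_inv inp n L"])
       apply (simp add: graph_inv_def frame_def)
      apply (erule (1) test_vertex)
    using assms by (simp_all add: graph_inv_def frame_def assign_def initial_state_def)
  then show ?thesis
    by (elim terminates_mono) (auto simp: graph_inv_def algebra_simps)
qed

text \<open>The constant is 7 + 6 + 4 + 2: as \<open>n\<close> and \<open>L\<close> are positive,
  every lower-order term is absorbed into L n^2.\<close>

lemma structure_learn_halts:
  assumes "n \<ge> 1" "L \<ge> 1"
  shows "halts_within structure_learn (learning_instance H n L X) (19 * real L * (real n)\<^sup>2)"
proof -
  let ?inp = "learning_instance H n L X"
  have "n * (n * (7 * L + 6) + 4) + 2 \<le> 19 * L * n\<^sup>2"
  proof -
    have "n * (n * (7 * L + 6) + 4) + 2 = 7 * (L * n\<^sup>2) + 6 * n\<^sup>2 + 4 * n + 2"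
      by (simp add: algebra_simps power2_eq_square)
    moreover have "n\<^sup>2 \<le> L * n\<^sup>2" "n \<le> n\<^sup>2" "1 \<le> n\<^sup>2"
      using assms by (simp_all add: power2_eq_square)
    ultimately have "n * (n * (7 * L + 6) + 4) + 2 \<le> 19 * (L * n\<^sup>2)" by linarith
    then show ?thesis by (simp only: mult.assoc)
  qed
  moreover obtain t s where "exec ?inp structure_learn (initial_state ?inp) t s"
      and "t \<le> n * (n * (7 * L + 6) + 4) + 2"
    using structure_learn[of n ?inp L] unfolding terminates_def
    by (auto simp: learning_instance_def)
  ultimately have "real t \<le> real (19 * L * n\<^sup>2)"
    by (intro of_nat_mono) (rule order_trans)
  then show ?thesis
    using \<open>exec _ _ _ t s\<close> unfolding halts_within_def by auto
qed

text \<open>Only entries below the diagonal become nonzero; they determine the graph because its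
  edges are unordered pairs of distinct vertices.\<close>

lemma structure_learn_outputs:
  assumes G: "simple_graph G" "verts G = {..<n}"
    and rec: "\<And>v w. v < n \<Longrightarrow> w < v \<Longrightarrow>
      (\<forall>l<L. {X l v, X l w} \<in> edges H) \<longleftrightarrow> {v, w} \<in> edges G"
  shows "outputs structure_learn (learning_instance H n L X) G"
proof -
  let ?inp = "learning_instance H n L X"
  obtain t s where ex: "exec ?inp structure_learn (initial_state ?inp) t s"
    and s: "\<And>a b. out s a b > 0 \<longleftrightarrow> b < a \<and> a < n \<and> compatible_samples ?inp a b L"
    using structure_learn[of n ?inp L] unfolding terminates_def
    by (auto simp: learning_instance_def)
  have comp: "compatible_samples ?inp a b L \<longleftrightarrow> (\<forall>l<L. {X l a, X l b} \<in> edges H)"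
    if "b < a" "a < n" for a b
    using that by (auto simp: compatible_samples_def learning_instance_def constraint_entry_def
        sample_entry_def split: if_splits)
  have out: "out s a b \<noteq> 0 \<longleftrightarrow> b < a \<and> a < n \<and> {a, b} \<in> edges G" for a b
    using s[of a b] comp rec by auto
  have "\<exists>v w. e = {v, w} \<and> w < v \<and> v < n" if e: "e \<in> edges G" for e
  proof -
    have "card e = 2" "e \<subseteq> {..<n}" using e G by (auto simp: simple_graph_def)
    then obtain x y where "e = {x, y}" "x \<noteq> y" "x < n" "y < n" by (auto simp: card_2_iff)
    then show ?thesis by (metis insert_commute linorder_neqE_nat)
  qed
  then have "edges G = {{v, w} |v w. v < n \<and> w < n \<and> out s v w \<noteq> 0}"
    unfolding out by fastforce
  then have "output_graph ?inp s = G"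
    using G by (simp add: output_graph_def learning_instance_def)
  then show ?thesis using ex unfolding outputs_def by blast
qed

subsection \<open>Sample complexity\<close>

text \<open>The event is a product over independent samples, each factor being at most 1 - 1 / (64
  q^2), which is bounded by an exponential via 1 + x \<le> exp x.\<close>

lemma prob_no_witness_le:
  assumes H: "constraint_graph q H" "H \<noteq> looped_complete q"
    and G: "simple_graph G" and col: "colorable H G" and dob: "dobrushin H G"
    and v: "v \<in> verts G" "w \<in> verts G" "v \<noteq> w" "{v, w} \<notin> edges G"
  shows "measure_pmf.prob (samples_pmf H G L) {X. \<forall>l<L. {X l v, X l w} \<in> edges H}
    \<le> exp (- (real L / (64 * (real q)\<^sup>2)))"
proof -
  define Om where "Om = colorings H G"
  define A where "A = {\<sigma>. {\<sigma> v, \<sigma> w} \<in> edges H}"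
  have V: "verts H = {1..q}" using H by (simp add: constraint_graph_def)
  have q: "q \<ge> 1" using exists_incompatible_pair[OF H] by (auto simp: V)
  have fin: "finite Om" and ne: "Om \<noteq> {}"
    using G col by (auto simp: Om_def V simple_graph_def colorable_def intro!: finite_colorings)
  have p: "measure_pmf.prob (coloring_pmf H G) B = card (Om \<inter> B) / card Om" for B
    unfolding coloring_pmf_def Om_def[symmetric] by (rule measure_pmf_of_set[OF ne fin])
  have c0: "card Om > 0" using fin ne by (simp add: card_gt_0_iff)
  have "Om \<inter> - A = {\<sigma>\<in>Om. {\<sigma> v, \<sigma> w} \<notin> edges H}" by (auto simp: A_def)
  then have "card Om \<le> 64 * (real q)\<^sup>2 * card (Om \<inter> - A)"
    using card_incompatible_ge[OF H G col dob v] by (simp add: Om_def)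
  then have "1 / (64 * (real q)\<^sup>2) \<le> measure_pmf.prob (coloring_pmf H G) (- A)"
    using c0 q by (simp add: p field_simps)
  then have pA: "measure_pmf.prob (coloring_pmf H G) A \<le> 1 - 1 / (64 * (real q)\<^sup>2)"
    using measure_pmf.prob_compl[of A "coloring_pmf H G"] by (simp add: Compl_eq_Diff_UNIV)
  also have "\<dots> \<le> exp (- (1 / (64 * (real q)\<^sup>2)))"
    using exp_ge_add_one_self[of "- (1 / (64 * (real q)\<^sup>2))"] by simp
  finally have le: "measure_pmf.prob (coloring_pmf H G) A \<le> exp (- (1 / (64 * (real q)\<^sup>2)))" .
  have "{X. \<forall>l<L. {X l v, X l w} \<in> edges H} = Pi {..<L} (\<lambda>_. A)" by (auto simp: A_def)
  then have "measure_pmf.prob (samples_pmf H G L) {X. \<forall>l<L. {X l v, X l w} \<in> edges H}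
      = measure_pmf.prob (coloring_pmf H G) A ^ L"
    unfolding samples_pmf_def by (simp add: measure_Pi_pmf_Pi)
  also have "\<dots> \<le> exp (- (1 / (64 * (real q)\<^sup>2))) ^ L" by (rule power_mono[OF le]) simp
  also have "\<dots> = exp (- (real L / (64 * (real q)\<^sup>2)))" by (simp add: exp_of_nat_mult[symmetric])
  finally show ?thesis .
qed

theorem theorem4:
  shows "\<exists>C > 0. \<exists>K > 0. \<forall>(q::nat) H. constraint_graph q H \<and> H \<noteq> looped_complete q \<longrightarrow>
    (\<exists>alg. \<forall>(n::nat) (\<epsilon>::real) G L.
       n \<ge> 1 \<and> 0 < \<epsilon> \<and> \<epsilon> < 1 \<and>
       simple_graph G \<and> verts G = {..<n} \<and> colorable H G \<and> dobrushin H G \<and>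
       L = nat \<lceil>C * (real q)\<^sup>2 * ln ((real n)\<^sup>2 / \<epsilon>)\<rceil> \<longrightarrow>
         measure_pmf.prob (samples_pmf H G L) {X. outputs alg (learning_instance H n L X) G} \<ge> 1 - \<epsilon> \<and>
         (\<forall>X \<in> set_pmf (samples_pmf H G L).
            halts_within alg (learning_instance H n L X) (K * real L * (real n)\<^sup>2)))"
proof (rule exI[of _ "64::real"], rule conjI, simp, rule exI[of _ "19::real"], rule conjI, simp,
    intro allI impI)
  \<comment> \<open>64 comes from the witness probability of a non-edge, 19 from the running
    time.\<close>
  fix q :: nat and H
  assume H: "constraint_graph q H \<and> H \<noteq> looped_complete q"
  show "\<exists>alg. \<forall>(n::nat) (\<epsilon>::real) G L.
       n \<ge> 1 \<and> 0 < \<epsilon> \<and> \<epsilon> < 1 \<and>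
       simple_graph G \<and> verts G = {..<n} \<and> colorable H G \<and> dobrushin H G \<and>
       L = nat \<lceil>64 * (real q)\<^sup>2 * ln ((real n)\<^sup>2 / \<epsilon>)\<rceil> \<longrightarrow>
         measure_pmf.prob (samples_pmf H G L) {X. outputs alg (learning_instance H n L X) G} \<ge> 1 - \<epsilon> \<and>
         (\<forall>X \<in> set_pmf (samples_pmf H G L).
            halts_within alg (learning_instance H n L X) (19 * real L * (real n)\<^sup>2))"
  \<comment> \<open>One fixed program serves every \<open>H\<close>, whose adjacency matrix is part
    of the input.\<close>
  proof (intro exI[of _ structure_learn] allI impI)
    fix n :: nat and \<epsilon> :: real and G L
    assume "n \<ge> 1 \<and> 0 < \<epsilon> \<and> \<epsilon> < 1 \<and>
       simple_graph G \<and> verts G = {..<n} \<and> colorable H G \<and> dobrushin H G \<and>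
       L = nat \<lceil>64 * (real q)\<^sup>2 * ln ((real n)\<^sup>2 / \<epsilon>)\<rceil>"
    then have n: "n \<ge> 1" and \<epsilon>: "0 < \<epsilon>" "\<epsilon> < 1" and G: "simple_graph G" "verts G = {..<n}"
      and col: "colorable H G" and dob: "dobrushin H G"
      and L: "L = nat \<lceil>64 * (real q)\<^sup>2 * ln ((real n)\<^sup>2 / \<epsilon>)\<rceil>" by auto
    have q: "q \<ge> 1" using exists_incompatible_pair[of q H] H by (auto simp: constraint_graph_def)
    \<comment> \<open>The logarithm is positive even for \<open>n = 1\<close>, as
      \<open>\<epsilon> < 1\<close>; hence \<open>L \<ge> 1\<close>, as the running time bound
      requires.\<close>
    have "1 < (real n)\<^sup>2 / \<epsilon>"
      using less_le_trans[OF \<epsilon>(2) one_le_power[of "real n" 2]] n \<epsilon> by simp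
    then have ln0: "ln ((real n)\<^sup>2 / \<epsilon>) > 0" by simp
    then have "64 * (real q)\<^sup>2 * ln ((real n)\<^sup>2 / \<epsilon>) > 0" using q by simp
    then have L1: "L \<ge> 1" and Lge: "64 * (real q)\<^sup>2 * ln ((real n)\<^sup>2 / \<epsilon>) \<le> real L"
      unfolding L by linarith+
    \<comment> \<open>Each non-edge occurs once, larger endpoint first, in the order in which the
      program tests it.\<close>
    define W where "W = {(v, w). v < n \<and> w < v \<and> {v, w} \<notin> edges G}"
    define Bad where "Bad p = {X. \<forall>l<L. {X l (fst p), X l (snd p)} \<in> edges H}" for p :: "nat \<times> nat"
    let ?M = "samples_pmf H G L"
    have WS: "W \<subseteq> {..<n} \<times> {..<n}" by (auto simp: W_def)
    then have finW: "finite W" by (rule finite_subset) simp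
    have cW: "card W \<le> n\<^sup>2"
      using card_mono[OF _ WS] by (simp add: power2_eq_square)
    have bad: "measure_pmf.prob ?M (Bad p) \<le> \<epsilon> / (real n)\<^sup>2" if "p \<in> W" for p
    proof -
      have "measure_pmf.prob ?M (Bad p) \<le> exp (- (real L / (64 * (real q)\<^sup>2)))"
        unfolding Bad_def
      proof (rule prob_no_witness_le[OF _ _ G(1) col dob])
        show "constraint_graph q H" "H \<noteq> looped_complete q" using H by blast+
        show "fst p \<in> verts G" "snd p \<in> verts G" "fst p \<noteq> snd p" "{fst p, snd p} \<notin> edges G"
          using that unfolding W_def G(2) by auto
      qed
      also have "\<dots> \<le> exp (- ln ((real n)\<^sup>2 / \<epsilon>))"
        using Lge q by (simp add: field_simps)
      also have "\<dots> = \<epsilon> / (real n)\<^sup>2"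
        using n \<epsilon> by (simp add: exp_minus)
      finally show ?thesis .
    qed
    \<comment> \<open>On the support every sample is a coloring, so edges always pass the test;
      outside the bad events every non-edge fails it.\<close>
    have supp: "X \<in> {X. outputs structure_learn (learning_instance H n L X) G}"
      if X: "X \<in> set_pmf ?M" and good: "X \<notin> (\<Union>p\<in>W. Bad p)" for X
    proof -
      have "finite (colorings H G)" "colorings H G \<noteq> {}"
        using H G col by (auto simp: constraint_graph_def colorable_def intro!: finite_colorings)
      then have "X l \<in> colorings H G" if "l < L" for l
        using X that by (auto simp: samples_pmf_def set_Pi_pmf PiE_dflt_def coloring_pmf_def)
      then have "\<forall>l<L. {X l v, X l w} \<in> edges H" if "v < n" "w < v" "{v, w} \<in> edges G" for v w
        using that G(2) by (simp add: colorings_def)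
      moreover have "\<not> (\<forall>l<L. {X l v, X l w} \<in> edges H)" if "v < n" "w < v" "{v, w} \<notin> edges G" for v w
      proof -
        have "(v, w) \<in> W" using that by (simp add: W_def)
        then have "X \<notin> Bad (v, w)" using good by blast
        then show ?thesis by (simp add: Bad_def)
      qed
      ultimately have "(\<forall>l<L. {X l v, X l w} \<in> edges H) \<longleftrightarrow> {v, w} \<in> edges G"
        if "v < n" "w < v" for v w using that by blast
      then show ?thesis using structure_learn_outputs[OF G] by blast
    qed
    let ?O = "{X. outputs structure_learn (learning_instance H n L X) G}"
    have "measure_pmf.prob ?M (\<Union>p\<in>W. Bad p) \<le> (\<Sum>p\<in>W. measure_pmf.prob ?M (Bad p))"
      using finW by (intro measure_pmf.finite_measure_subadditive_finite) auto
    also have "\<dots> \<le> (\<Sum>p\<in>W. \<epsilon> / (real n)\<^sup>2)" using bad by (rule sum_mono)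
    also have "\<dots> = card W * (\<epsilon> / (real n)\<^sup>2)" by simp
    also have "\<dots> \<le> real (n\<^sup>2) * (\<epsilon> / (real n)\<^sup>2)"
      using cW \<epsilon> by (intro mult_right_mono of_nat_mono) auto
    also have "\<dots> = \<epsilon>" using n by simp
    finally have union: "measure_pmf.prob ?M (\<Union>p\<in>W. Bad p) \<le> \<epsilon>" .
    have "1 = measure_pmf.prob ?M (set_pmf ?M)"
      by (simp add: measure_pmf.prob_eq_1 AE_measure_pmf)
    also have "\<dots> \<le> measure_pmf.prob ?M (?O \<union> (\<Union>p\<in>W. Bad p))"
      using supp by (intro measure_pmf.finite_measure_mono) auto
    also have "\<dots> \<le> measure_pmf.prob ?M ?O + measure_pmf.prob ?M (\<Union>p\<in>W. Bad p)"
      by (rule measure_Un_le) auto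
    finally have "measure_pmf.prob ?M ?O \<ge> 1 - \<epsilon>" using union by linarith
    then show "measure_pmf.prob ?M ?O \<ge> 1 - \<epsilon> \<and>
        (\<forall>X \<in> set_pmf ?M. halts_within structure_learn (learning_instance H n L X)
           (19 * real L * (real n)\<^sup>2))"
      using structure_learn_halts[OF n L1] by blast
  qed
qed

end
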